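(* Let $m,d$ be positive integers and let $U_{m,d}$ be the uniform matroid of rank $d$ on $m+d$ elements. Let $z_{m,d}^i$ denote the coefficient of $t^i$ in the $Z$-polynomial $Z_{U_{m,d}}(t)$. Then for every $0\le i\le d$, \[ z_{m,d}^i=\frac{\binom{d+m}{i+m}\binom{d+m}{i}}{\binom{d+m}{m}}\sum_{h=0}^{m-1}\frac{i(h-m+1)+m}{(h+1)m}\binom{i-1+h}{h}\binom{d-i+h}{h}. \]
   Context: Binomial coefficients are $\binom{x}{h}=x(x-1)\cdots(x-h+1)/h!$ for integers $h\ge 0$ (so $\binom{-1}{0}=1$). For a loopless matroid $M$ with lattice of flats $L(M)$, characteristic polynomial $\chi_M(t)$ and rank $\operatorname{rk}M$, the Kazhdan–Lusztig polynomial $P_M(t)$ is the unique assignment with $P_M=1$ if $\operatorname{rk}M=0$, $\deg P_M<\frac12\operatorname{rk}M$ if $\operatorname{rk}M>0$, and $t^{\operatorname{rk}M}P_M(t^{-1})=\sum_{F\in L(M)}\chi_{M_F}(t)P_{M^F}(t)$, where $M_F$ is the restriction of $M$ to the flat $F$ and $M^F$ is the contraction of $M$ by $F$. The $Z$-polynomial is $Z_M(t)=\sum_{F\in L(M)}t^{\operatorname{rk}M_F}P_{M^F}(t)$. *)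

theory Defs
  imports Complex_Main "HOL-Computational_Algebra.Polynomial"
begin

record 'a matroid =
  ground :: "'a set"
  indeps :: "'a set set"

definition matroid :: "'a matroid \<Rightarrow> bool" where
  "matroid M \<longleftrightarrow>
     finite (ground M) \<and>
     (\<forall>I\<in>indeps M. I \<subseteq> ground M) \<and>
     {} \<in> indeps M \<and>
     (\<forall>I\<in>indeps M. \<forall>J. J \<subseteq> I \<longrightarrow> J \<in> indeps M) \<and>
     (\<forall>I\<in>indeps M. \<forall>J\<in>indeps M. card I < card J \<longrightarrow>
        (\<exists>x\<in>J - I. insert x I \<in> indeps M))"

definition loopless :: "'a matroid \<Rightarrow> bool" where
  "loopless M \<longleftrightarrow> (\<forall>x\<in>ground M. {x} \<in> indeps M)"

definition rank_of :: "'a matroid \<Rightarrow> 'a set \<Rightarrow> nat" where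
  "rank_of M X = Max (card ` {I \<in> indeps M. I \<subseteq> X})"

definition rk :: "'a matroid \<Rightarrow> nat" where
  "rk M = rank_of M (ground M)"

definition flats :: "'a matroid \<Rightarrow> 'a set set" where
  "flats M = {F. F \<subseteq> ground M \<and> (\<forall>x\<in>ground M - F. rank_of M F < rank_of M (insert x F))}"

definition basis_in :: "'a matroid \<Rightarrow> 'a set \<Rightarrow> 'a set \<Rightarrow> bool" where
  "basis_in M X B \<longleftrightarrow> B \<in> indeps M \<and> B \<subseteq> X \<and>
     (\<forall>I\<in>indeps M. B \<subseteq> I \<longrightarrow> I \<subseteq> X \<longrightarrow> I = B)"

definition restriction :: "'a matroid \<Rightarrow> 'a set \<Rightarrow> 'a matroid" where
  "restriction M X = \<lparr>ground = X, indeps = {I \<in> indeps M. I \<subseteq> X}\<rparr>"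

definition contraction :: "'a matroid \<Rightarrow> 'a set \<Rightarrow> 'a matroid" where
  "contraction M X = \<lparr>ground = ground M - X,
     indeps = {I. I \<subseteq> ground M - X \<and> (\<exists>B. basis_in M X B \<and> I \<union> B \<in> indeps M)}\<rparr>"

definition uniform_matroid :: "nat \<Rightarrow> 'a set \<Rightarrow> 'a matroid" where
  "uniform_matroid d E = \<lparr>ground = E, indeps = {I. I \<subseteq> E \<and> card I \<le> d}\<rparr>"

text \<open>Moebius function of a family \<open>L\<close> of finite sets ordered by inclusion. The finiteness
  test only serves termination.\<close>

function moebius :: "'a set set \<Rightarrow> 'a set \<Rightarrow> 'a set \<Rightarrow> int" where
  "moebius L X Y =
     (if X = Y then 1
      else if X \<subset> Y \<and> finite Y then - (\<Sum>W\<in>{W \<in> L. X \<subseteq> W \<and> W \<subset> Y}. moebius L X W)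
      else 0)"
  by pat_completeness auto
termination
  by (relation "measure (\<lambda>(L, X, Y). card Y)") (auto intro: psubset_card_mono)

declare moebius.simps [simp del]

text \<open>In a loopless matroid the least flat is the empty set.\<close>

definition char_poly :: "'a matroid \<Rightarrow> int poly" where
  "char_poly M = (\<Sum>F\<in>flats M. monom (moebius (flats M) {} F) (rk M - rank_of M F))"

text \<open>\<open>t^n * p(1/t)\<close> for a polynomial \<open>p\<close> of degree at most \<open>n\<close>: \<open>reflect_poly p\<close> is
  \<open>t^(degree p) * p(1/t)\<close>.\<close>

definition rev_poly :: "nat \<Rightarrow> int poly \<Rightarrow> int poly" where
  "rev_poly n p = monom 1 (n - degree p) * reflect_poly p"

definition kl_assignment :: "('a matroid \<Rightarrow> int poly) \<Rightarrow> bool" where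
  "kl_assignment P \<longleftrightarrow>
     (\<forall>M. matroid M \<longrightarrow> loopless M \<longrightarrow>
        (rk M = 0 \<longrightarrow> P M = 1) \<and>
        (rk M > 0 \<longrightarrow> real (degree (P M)) < real (rk M) / 2) \<and>
        rev_poly (rk M) (P M) =
          (\<Sum>F\<in>flats M. char_poly (restriction M F) * P (contraction M F)))"

text \<open>The assignment is only determined on loopless matroids; the value 0 elsewhere is a dummy
  that makes it unique as a total function.\<close>

definition kl_poly :: "'a matroid \<Rightarrow> int poly" where
  "kl_poly = (THE P. kl_assignment P \<and> (\<forall>M. \<not> (matroid M \<and> loopless M) \<longrightarrow> P M = 0))"

definition Z_poly :: "'a matroid \<Rightarrow> int poly" where
  "Z_poly M = (\<Sum>F\<in>flats M. monom 1 (rk (restriction M F)) * kl_poly (contraction M F))"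

end

theory Submission imports Defs begin

text \<open>
  Over any interval of the lattice of flats the characteristic polynomials sum to a power of \<open>t\<close>,
  so the defining equations of the Kazhdan--Lusztig polynomials hold for all loopless matroids if
  and only if every \<open>Z\<close>-polynomial is palindromic of degree the rank. Since
  \<open>Z = P + (terms from proper contractions)\<close> and \<open>deg P < rk / 2\<close>, palindromicity determines \<open>P\<close>
  recursively and can always be achieved; this gives existence and uniqueness.

  Nonempty proper flats of a uniform matroid contract to smaller uniform matroids with the same
  \<open>m\<close>, so it suffices to exhibit closed formulas \<open>p\<close> and \<open>z\<close> such that \<open>p\<close> vanishes in degrees at
  least \<open>d / 2\<close>, \<open>z\<close> is symmetric under \<open>i \<mapsto> d - i\<close>, and \<open>z\<close> arises from \<open>p\<close> by the convolution
  \<open>z (d, i) = (\<Sum>k. (d + m choose k) p (d - k, i - k))\<close>. With \<open>n = d - i\<close>, both sides of the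
  convolution, suitably normalised, have second difference
  \<open>(n + i choose i - 1) (n + m choose m - 1)\<close> in \<open>n\<close> and the same initial values.
\<close>

subsection \<open>Rank and flats of minors\<close>

lemma rank_of_restriction: "Y \<subseteq> X \<Longrightarrow> rank_of (restriction M X) Y = rank_of M Y"
  unfolding rank_of_def restriction_def
  by (intro arg_cong[where f = Max] arg_cong[where f = "image card"]) auto

lemma ground_restriction [simp]: "ground (restriction M X) = X"
  by (simp add: restriction_def)

lemma ground_contraction [simp]: "ground (contraction M X) = ground M - X"
  by (simp add: contraction_def)

lemma basis_in_indep: "basis_in M X B \<Longrightarrow> B \<in> indeps M"
  and basis_in_subset: "basis_in M X B \<Longrightarrow> B \<subseteq> X"
  and basis_in_maximal: "basis_in M X B \<Longrightarrow> I \<in> indeps M \<Longrightarrow> B \<subseteq> I \<Longrightarrow> I \<subseteq> X \<Longrightarrow> I = B"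
  by (simp_all add: basis_in_def)

context
  fixes M :: "'a matroid"
  assumes matroid: "matroid M"
begin

lemma matroid_finite_ground: "finite (ground M)"
  using matroid by (simp add: matroid_def)

lemma matroid_indep_subset: "I \<in> indeps M \<Longrightarrow> I \<subseteq> ground M"
  using matroid by (simp add: matroid_def)

lemma matroid_indep_finite: "I \<in> indeps M \<Longrightarrow> finite I"
  using matroid_indep_subset matroid_finite_ground finite_subset by blast

lemma matroid_indep_mono: "I \<in> indeps M \<Longrightarrow> J \<subseteq> I \<Longrightarrow> J \<in> indeps M"
  using matroid unfolding matroid_def by blast

lemma matroid_empty_indep: "{} \<in> indeps M"
  using matroid by (simp add: matroid_def)

lemma matroid_exchange:
  assumes "I \<in> indeps M" "J \<in> indeps M" "card I < card J"
  obtains x where "x \<in> J" "x \<notin> I" "insert x I \<in> indeps M"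
proof -
  have "\<forall>I\<in>indeps M. \<forall>J\<in>indeps M. card I < card J \<longrightarrow> (\<exists>x\<in>J - I. insert x I \<in> indeps M)"
    using matroid by (simp add: matroid_def)
  then show thesis using assms that by blast
qed

lemma matroid_finite_indeps: "finite (indeps M)"
proof (rule finite_subset)
  show "indeps M \<subseteq> Pow (ground M)"
    using matroid_indep_subset by blast
qed (simp add: matroid_finite_ground)

lemma matroid_extend_basis:
  assumes "I \<in> indeps M" "I \<subseteq> X"
  obtains B where "basis_in M X B" "I \<subseteq> B"
proof -
  have fin: "finite {J \<in> indeps M. J \<subseteq> X}"
    using matroid_finite_indeps by simp
  obtain B where "B \<in> {J \<in> indeps M. J \<subseteq> X}" "I \<subseteq> B"
    and "\<And>J. J \<in> {J \<in> indeps M. J \<subseteq> X} \<Longrightarrow> B \<subseteq> J \<Longrightarrow> B = J"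
    using finite_has_maximal2[OF fin, of I] assms by auto
  then have "basis_in M X B"
    unfolding basis_in_def by blast
  then show ?thesis using \<open>I \<subseteq> B\<close> that by blast
qed

lemma matroid_basis_exists:
  obtains B where "basis_in M X B"
  using matroid_extend_basis[OF matroid_empty_indep] by blast

lemma basis_in_card_max:
  assumes "basis_in M X B" "J \<in> indeps M" "J \<subseteq> X"
  shows "card J \<le> card B"
proof (rule ccontr)
  assume "\<not> card J \<le> card B"
  then obtain x where "x \<in> J" "x \<notin> B" "insert x B \<in> indeps M"
    using matroid_exchange[of B J] assms unfolding basis_in_def by force
  then show False
    using assms unfolding basis_in_def by blast
qed

lemma rank_of_basis: "basis_in M X B \<Longrightarrow> rank_of M X = card B"
  unfolding rank_of_def
proof (rule Max_eqI)
  assume B: "basis_in M X B"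
  show "finite (card ` {I \<in> indeps M. I \<subseteq> X})" using matroid_finite_indeps by simp
  show "card B \<in> card ` {I \<in> indeps M. I \<subseteq> X}"
    using basis_in_indep[OF B] basis_in_subset[OF B] by blast
  show "k \<le> card B" if "k \<in> card ` {I \<in> indeps M. I \<subseteq> X}" for k
    using that basis_in_card_max[OF B] by blast
qed

lemma indep_card_le_rank: "I \<in> indeps M \<Longrightarrow> I \<subseteq> X \<Longrightarrow> card I \<le> rank_of M X"
proof -
  assume I: "I \<in> indeps M" "I \<subseteq> X"
  obtain B where B: "basis_in M X B" by (rule matroid_basis_exists)
  then show ?thesis using basis_in_card_max[OF B I] rank_of_basis[OF B] by simp
qed

lemma rank_of_le_card: "finite X \<Longrightarrow> rank_of M X \<le> card X"
proof -
  assume X: "finite X"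
  obtain B where B: "basis_in M X B" by (rule matroid_basis_exists)
  then have "B \<subseteq> X" by (simp add: basis_in_def)
  then show ?thesis using card_mono[OF X, of B] rank_of_basis[OF B] by simp
qed

lemma indep_iff_rank:
  assumes "finite I"
  shows "I \<in> indeps M \<longleftrightarrow> rank_of M I = card I"
proof
  assume "I \<in> indeps M"
  then show "rank_of M I = card I"
    using indep_card_le_rank[of I I] rank_of_le_card[OF assms] by simp
next
  assume r: "rank_of M I = card I"
  obtain B where "basis_in M I B" by (rule matroid_basis_exists)
  then have "B \<subseteq> I" "card B = card I" "B \<in> indeps M"
    using r rank_of_basis[of I B] by (auto simp: basis_in_def)
  then show "I \<in> indeps M"
    using card_subset_eq[OF assms] by blast
qed

lemma rank_of_mono: "X \<subseteq> Y \<Longrightarrow> rank_of M X \<le> rank_of M Y"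
proof -
  assume XY: "X \<subseteq> Y"
  obtain B where B: "basis_in M X B" by (rule matroid_basis_exists)
  then have "B \<in> indeps M" "B \<subseteq> Y" using XY by (auto simp: basis_in_def)
  then show ?thesis using rank_of_basis[OF B] indep_card_le_rank[of B Y] by simp
qed

lemma rank_of_empty [simp]: "rank_of M {} = 0"
  using rank_of_le_card[of "{}"] by simp

text \<open>A local form of submodularity. If \<open>x\<close> raised the rank of \<open>G\<close>,
  a basis \<open>A\<close> of \<open>H\<close> could be extended to a basis \<open>B\<close> of
  \<open>G\<close> and then to a basis \<open>C\<close> of \<open>insert x G\<close>. Maximality of
  \<open>B\<close> forces \<open>x\<close> into \<open>C\<close>, so \<open>insert x A\<close> is
  independent and \<open>x\<close> already raises the rank of \<open>H\<close>.\<close>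

lemma rank_of_insert_eq_superset:
  assumes "rank_of M (insert x H) = rank_of M H" "H \<subseteq> G"
  shows "rank_of M (insert x G) = rank_of M G"
proof (rule ccontr)
  assume "rank_of M (insert x G) \<noteq> rank_of M G"
  then have lt: "rank_of M G < rank_of M (insert x G)"
    using rank_of_mono[OF subset_insertI, of G x] by linarith
  obtain A where A: "basis_in M H A" by (rule matroid_basis_exists)
  then have "A \<in> indeps M" "A \<subseteq> G" using assms by (auto dest: basis_in_indep basis_in_subset)
  then obtain B where B: "basis_in M G B" "A \<subseteq> B" by (rule matroid_extend_basis)
  then have "B \<in> indeps M" "B \<subseteq> insert x G" by (auto dest: basis_in_indep basis_in_subset)
  then obtain C where C: "basis_in M (insert x G) C" "B \<subseteq> C" by (rule matroid_extend_basis)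
  have "card B < card C" using lt rank_of_basis[OF B(1)] rank_of_basis[OF C(1)] by simp
  have "x \<in> C"
  proof (rule ccontr)
    assume "x \<notin> C"
    then have "C \<subseteq> G" "C \<in> indeps M" using C(1) by (auto dest: basis_in_indep basis_in_subset)
    then have "C = B" using basis_in_maximal[OF B(1)] C(2) by blast
    then show False using \<open>card B < card C\<close> by simp
  qed
  have "x \<notin> G" using lt by (auto simp: insert_absorb)
  then have "x \<notin> A" using A assms by (auto dest: basis_in_indep basis_in_subset)
  have "insert x A \<in> indeps M"
    using matroid_indep_mono[of C "insert x A"] C B \<open>x \<in> C\<close>
        by (auto dest: basis_in_indep basis_in_subset)
  moreover have "insert x A \<subseteq> insert x H" using A by (auto dest: basis_in_indep basis_in_subset)
  ultimately have "card (insert x A) \<le> rank_of M (insert x H)" by (rule indep_card_le_rank)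
  moreover have "card (insert x A) = Suc (rank_of M H)"
    using A \<open>x \<notin> A\<close> matroid_indep_finite[of A] rank_of_basis[OF A] by (simp add: basis_in_indep)
  ultimately show False using assms by simp
qed

lemma finite_flats: "finite (flats M)"
proof (rule finite_subset)
  show "flats M \<subseteq> Pow (ground M)" by (auto simp: flats_def)
qed (simp add: matroid_finite_ground)

text \<open>The flat condition in the restriction tests only points of \<open>G\<close>. Points
  outside \<open>G\<close> raise the rank of the flat \<open>G\<close>, hence by
  \<open>rank_of_insert_eq_superset\<close> the rank of each of its subsets.\<close>

lemma flats_restriction:
  assumes "G \<in> flats M"
  shows "flats (restriction M G) = {H \<in> flats M. H \<subseteq> G}"
proof -
  have G: "G \<subseteq> ground M" "\<And>x. x \<in> ground M - G \<Longrightarrow> rank_of M G < rank_of M (insert x G)"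
    using assms by (auto simp: flats_def)
  have out: "rank_of M H < rank_of M (insert x H)"
    if "H \<subseteq> G" "x \<in> ground M - G" for H x
  proof -
    have "rank_of M (insert x H) \<noteq> rank_of M H"
      using rank_of_insert_eq_superset[of x H G] G(2)[of x] that by auto
    then show ?thesis using rank_of_mono[OF subset_insertI, of H x] by linarith
  qed
  have "rank_of M H < rank_of M (insert x H)"
    if "H \<subseteq> G" "\<forall>y\<in>G - H. rank_of M H < rank_of M (insert y H)" "x \<in> ground M" "x \<notin> H" for H x
    using that out[of H x] by (cases "x \<in> G") auto
  then show ?thesis
    using G unfolding flats_def by (auto simp: rank_of_restriction)
qed

text \<open>The definition of \<open>contraction\<close> asks for some basis of \<open>X\<close>;
  any fixed one serves. Extend \<open>B\<close> to a basis \<open>C\<close> of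
  \<open>I \<union> X\<close>. Maximality of \<open>B\<close> gives \<open>C \<inter> X = B\<close>,
  so \<open>C\<close> lies in \<open>I \<union> B\<close>, and equal cardinality of the bases
  \<open>B\<close> and \<open>B'\<close> of \<open>X\<close> forces
  \<open>C = I \<union> B\<close>.\<close>

lemma contraction_indep_iff:
  assumes B: "basis_in M X B"
  shows "I \<in> indeps (contraction M X) \<longleftrightarrow> I \<subseteq> ground M - X \<and> I \<union> B \<in> indeps M"
proof
  assume "I \<in> indeps (contraction M X)"
  then obtain B' where I: "I \<subseteq> ground M - X" and B': "basis_in M X B'" "I \<union> B' \<in> indeps M"
    by (auto simp: contraction_def)
  have fin: "finite I" "finite B" "finite B'"
    using matroid_indep_finite[OF B'(2)] matroid_indep_finite[of B] B
        by (auto dest: basis_in_indep basis_in_subset)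
  have disj: "I \<inter> B = {}" "I \<inter> B' = {}" using I B B' by (auto dest: basis_in_indep basis_in_subset)
  have "B \<in> indeps M" "B \<subseteq> I \<union> X" using B by (auto dest: basis_in_indep basis_in_subset)
  then obtain C where C: "basis_in M (I \<union> X) C" "B \<subseteq> C" by (rule matroid_extend_basis)
  have "C \<inter> X \<in> indeps M" using C matroid_indep_mono[of C]
      by (auto dest: basis_in_indep basis_in_subset)
  then have "C \<inter> X = B" using basis_in_maximal[OF B, of "C \<inter> X"] C(2) basis_in_subset[OF B] by blast
  then have sub: "C \<subseteq> I \<union> B" using C by (auto dest: basis_in_indep basis_in_subset)
  have "card (I \<union> B') \<le> card C"
    using basis_in_card_max[OF C(1) B'(2)] B'(1) by (auto dest: basis_in_indep basis_in_subset)
  moreover have "card (I \<union> B') = card (I \<union> B)"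
    using fin disj rank_of_basis[OF B] rank_of_basis[OF B'(1)] by (simp add: card_Un_disjoint)
  ultimately have "C = I \<union> B"
    using sub fin by (intro card_seteq) auto
  then show "I \<subseteq> ground M - X \<and> I \<union> B \<in> indeps M"
    using C I by (auto dest: basis_in_indep basis_in_subset)
qed (use B in \<open>auto simp: contraction_def\<close>)

lemma matroid_contraction: "matroid (contraction M X)"
proof -
  obtain B where B: "basis_in M X B" by (rule matroid_basis_exists)
  note iff = contraction_indep_iff[OF B]
  have ex: "\<exists>x\<in>J - I. insert x I \<in> indeps (contraction M X)"
    if IJ: "I \<in> indeps (contraction M X)" "J \<in> indeps (contraction M X)" "card I < card J" for I J
  proof -
    have ind: "I \<union> B \<in> indeps M" "J \<union> B \<in> indeps M" using IJ iff by auto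
    have "I \<inter> B = {}" "J \<inter> B = {}" using IJ iff B by (auto dest: basis_in_indep basis_in_subset)
    then have "card (I \<union> B) < card (J \<union> B)"
      using IJ(3) matroid_indep_finite[OF ind(1)] matroid_indep_finite[OF ind(2)]
      by (simp add: card_Un_disjoint)
    then obtain x where "x \<in> J \<union> B" "x \<notin> I \<union> B" "insert x (I \<union> B) \<in> indeps M"
      using matroid_exchange ind by blast
    then have "x \<in> J - I \<and> insert x I \<in> indeps (contraction M X)"
      using IJ(1,2) unfolding iff by auto
    then show ?thesis by blast
  qed
  have sub: "J \<in> indeps (contraction M X)" if "I \<in> indeps (contraction M X)" "J \<subseteq> I" for I J
    using that iff matroid_indep_mono[of "I \<union> B" "J \<union> B"] by auto
  have "{} \<in> indeps (contraction M X)"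
    using B iff by (auto dest: basis_in_indep basis_in_subset)
  moreover have "I \<subseteq> ground (contraction M X)" if "I \<in> indeps (contraction M X)" for I
    using that iff by simp
  ultimately show ?thesis
    unfolding matroid_def using matroid_finite_ground sub ex
    by (intro conjI ballI allI impI) simp_all
qed

end

text \<open>A basis of \<open>Y\<close> in the contraction together with a basis of \<open>X\<close>
  is a basis of \<open>X \<union> Y\<close>, and the two parts are disjoint.\<close>

lemma rank_of_contraction:
  assumes M: "matroid M" and Y: "Y \<subseteq> ground M - X"
  shows "rank_of (contraction M X) Y = rank_of M (X \<union> Y) - rank_of M X"
proof -
  obtain B where B: "basis_in M X B" by (rule matroid_basis_exists[OF M])
  obtain I where I: "basis_in (contraction M X) Y I"
    by (rule matroid_basis_exists[OF matroid_contraction[OF M]])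
  note iff = contraction_indep_iff[OF M B]
  have "basis_in M (X \<union> Y) (I \<union> B)"
    unfolding basis_in_def
  proof (intro conjI ballI impI)
    show "I \<union> B \<in> indeps M" "I \<union> B \<subseteq> X \<union> Y"
      using I B iff by (auto dest: basis_in_indep basis_in_subset)
    fix J assume J: "J \<in> indeps M" "I \<union> B \<subseteq> J" "J \<subseteq> X \<union> Y"
    have "J \<inter> X \<in> indeps M" using matroid_indep_mono[OF M J(1)] by simp
    then have JX: "J \<inter> X = B" using basis_in_maximal[OF B, of "J \<inter> X"] J(2) basis_in_subset[OF B]
        by blast
    then have "(J - X) \<union> B = J" by blast
    then have "J - X \<in> indeps (contraction M X)"
      using iff J matroid_indep_subset[OF M J(1)] by auto
    moreover have "I \<subseteq> J - X" "J - X \<subseteq> Y" using I J Y by (auto dest: basis_in_indep basis_in_subset)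
    ultimately have "J - X = I" using basis_in_maximal[OF I] by blast
    then show "J = I \<union> B" using JX by blast
  qed
  moreover have "I \<inter> B = {}"
    using basis_in_subset[OF I] basis_in_subset[OF B] Y by blast
  moreover have "finite (I \<union> B)"
    using matroid_indep_finite[OF M basis_in_indep] calculation(1) by blast
  ultimately show ?thesis
    using rank_of_basis[OF M] rank_of_basis[OF M B] rank_of_basis[OF matroid_contraction[OF M] I]
    by (simp add: card_Un_disjoint)
qed

text \<open>Ranks in the contraction differ from ranks in \<open>M\<close> by the constant
  \<open>rank_of M F\<close>, so the same rank increases are tested on both sides.\<close>

lemma flats_contraction:
  assumes M: "matroid M" and F: "F \<subseteq> ground M"
  shows "flats (contraction M F) = (\<lambda>G. G - F) ` {G \<in> flats M. F \<subseteq> G}"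
proof -
  have iff: "H \<in> flats (contraction M F) \<longleftrightarrow> F \<union> H \<in> flats M" if H: "H \<subseteq> ground M - F" for H
  proof -
    have "rank_of (contraction M F) H < rank_of (contraction M F) (insert x H) \<longleftrightarrow>
        rank_of M (F \<union> H) < rank_of M (insert x (F \<union> H))" if x: "x \<in> ground M - (F \<union> H)" for x
      using rank_of_contraction[OF M, of H F] rank_of_contraction[OF M, of "insert x H" F]
        rank_of_mono[OF M, of F "F \<union> H"] x H by auto
    then show ?thesis
      using H F M by (auto simp: flats_def)
  qed
  show ?thesis
  proof (intro equalityI subsetI)
    fix H assume "H \<in> flats (contraction M F)"
    then have H: "H \<subseteq> ground M - F" "F \<union> H \<in> flats M"
      using iff M by (auto simp: flats_def)
    then have "H = (F \<union> H) - F" by blast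
    then show "H \<in> (\<lambda>G. G - F) ` {G \<in> flats M. F \<subseteq> G}" using H by blast
  next
    fix H assume "H \<in> (\<lambda>G. G - F) ` {G \<in> flats M. F \<subseteq> G}"
    then obtain G where G: "G \<in> flats M" "F \<subseteq> G" "H = G - F" by blast
    then have "F \<union> H = G" "H \<subseteq> ground M - F" by (auto simp: flats_def)
    then show "H \<in> flats (contraction M F)" using iff G by simp
  qed
qed

text \<open>Rank functions determine independence through \<open>indep_iff_rank\<close>. Comparing
  them avoids tracking the bases chosen in iterated contractions.\<close>

lemma matroid_eqI:
  fixes M N :: "'a matroid"
  assumes M: "matroid M" and N: "matroid N" and g: "ground M = ground N"
    and r: "\<And>X. X \<subseteq> ground M \<Longrightarrow> rank_of M X = rank_of N X"
  shows "M = N"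
proof -
  have "I \<in> indeps M \<longleftrightarrow> I \<in> indeps N" for I
  proof (cases "I \<subseteq> ground M")
    case True
    then have "finite I" using matroid_finite_ground[OF M] finite_subset by blast
    then show ?thesis using True indep_iff_rank[OF M] indep_iff_rank[OF N] r by simp
  qed (use matroid_indep_subset M N g in blast)
  then show ?thesis using g by (intro matroid.equality) auto
qed

text \<open>The rank differences given by \<open>rank_of_contraction\<close> telescope.\<close>

lemma contraction_contraction:
  assumes M: "matroid M" and "F \<subseteq> G" "G \<subseteq> ground M"
  shows "contraction (contraction M F) (G - F) = contraction M G"
proof (rule matroid_eqI)
  note MF = matroid_contraction[OF M, of F]
  show "matroid (contraction (contraction M F) (G - F))" "matroid (contraction M G)"
    using matroid_contraction MF M by blast+
  show "ground (contraction (contraction M F) (G - F)) = ground (contraction M G)"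
    using assms MF by auto
  fix X assume "X \<subseteq> ground (contraction (contraction M F) (G - F))"
  then have X: "X \<subseteq> ground M - F - (G - F)" using M MF by simp
  then have "X \<subseteq> ground M - G" using assms by auto
  moreover have "G - F \<subseteq> ground M - F" "X \<subseteq> ground M - F" using X assms by auto
  moreover have "F \<union> (G - F \<union> X) = G \<union> X" "F \<union> (G - F) = G" using assms by auto
  moreover have "rank_of M F \<le> rank_of M G" "rank_of M G \<le> rank_of M (G \<union> X)"
    using rank_of_mono[OF M] assms by auto
  ultimately show "rank_of (contraction (contraction M F) (G - F)) X = rank_of (contraction M G) X"
    using X assms rank_of_contraction[OF MF, of X "G - F"] rank_of_contraction[OF M, of X G]
      rank_of_contraction[OF M, of "G - F" F] rank_of_contraction[OF M, of "G - F \<union> X" F]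
    by auto
qed

lemma contraction_empty:
  assumes "matroid M"
  shows "contraction M {} = M"
  by (rule matroid_eqI) (use assms in \<open>auto simp: matroid_contraction rank_of_contraction\<close>)

lemma loopless_contraction:
  assumes M: "matroid M" and F: "F \<in> flats M"
  shows "loopless (contraction M F)"
  unfolding loopless_def
proof
  fix x assume "x \<in> ground (contraction M F)"
  then have x: "x \<in> ground M - F" using M by simp
  then have "rank_of M F < rank_of M (insert x F)" using F by (auto simp: flats_def)
  then have "rank_of (contraction M F) {x} = 1"
    using rank_of_contraction[OF M, of "{x}" F] x
      rank_of_le_card[OF matroid_contraction[OF M], of "{x}" F] by auto
  then show "{x} \<in> indeps (contraction M F)"
    using indep_iff_rank[OF matroid_contraction[OF M], of "{x}"] by simp
qed

lemma empty_in_flats: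
  assumes M: "matroid M" and "loopless M"
  shows "{} \<in> flats M"
proof -
  have "rank_of M {x} = 1" if "x \<in> ground M" for x
    using that assms indep_iff_rank[OF M, of "{x}"] by (auto simp: loopless_def)
  then show ?thesis using M by (simp add: flats_def)
qed

lemma rk_contraction:
  assumes "matroid M" "F \<subseteq> ground M"
  shows "rk (contraction M F) = rk M - rank_of M F"
  using assms rank_of_contraction[of M "ground M - F" F]
  by (simp add: rk_def Un_absorb1 Un_Diff_cancel)

subsection \<open>Moebius functions of families of sets\<close>

lemma sum_moebius_right:
  assumes "finite L" "X \<in> L" "Y \<in> L" "finite Y" "X \<subseteq> Y"
  shows "(\<Sum>W | W \<in> L \<and> X \<subseteq> W \<and> W \<subseteq> Y. moebius L X W) = (if X = Y then 1 else 0)"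
proof (cases "X = Y")
  case True
  then have "{W. W \<in> L \<and> X \<subseteq> W \<and> W \<subseteq> Y} = {Y}" using assms by auto
  then show ?thesis using True by (simp add: moebius.simps)
next
  case False
  have "{W. W \<in> L \<and> X \<subseteq> W \<and> W \<subseteq> Y} = insert Y {W \<in> L. X \<subseteq> W \<and> W \<subset> Y}"
    using assms by auto
  moreover have "moebius L X Y = - (\<Sum>W\<in>{W \<in> L. X \<subseteq> W \<and> W \<subset> Y}. moebius L X W)"
    using False assms by (subst moebius.simps) auto
  ultimately show ?thesis using False assms by simp
qed

text \<open>A one-sided inverse of the zeta function of a finite poset is two-sided.\<close>

lemma sum_moebius_left:
  assumes L: "finite L" "\<And>W. W \<in> L \<Longrightarrow> finite W" and "X \<in> L" "Y \<in> L" "X \<subseteq> Y"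
  shows "(\<Sum>W | W \<in> L \<and> X \<subseteq> W \<and> W \<subseteq> Y. moebius L W Y) = (if X = Y then 1 else 0)"
  using assms(4,5)
proof (induction "card Y" arbitrary: Y rule: less_induct)
  case less
  \<comment> \<open>\<open>S V\<close> is the sum to be evaluated, with upper end \<open>V\<close>.
    Adding it over all \<open>V\<close> up to \<open>Y\<close> and exchanging the sums leaves
    right-hand Moebius sums, with total 1. The induction hypothesis gives every \<open>S V\<close>
    with \<open>V\<close> strictly below \<open>Y\<close>, so \<open>S Y\<close> can be solved
    for.\<close>
  define S where "S V = (\<Sum>W | W \<in> L \<and> X \<subseteq> W \<and> W \<subseteq> V. moebius L W V)" for V
  have "(\<Sum>V | V \<in> L \<and> X \<subseteq> V \<and> V \<subseteq> Y. S V) =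
      (\<Sum>V | V \<in> L \<and> X \<subseteq> V \<and> V \<subseteq> Y. \<Sum>W | W \<in> L \<and> X \<subseteq> W \<and> W \<subseteq> V. moebius L W V)"
    by (simp add: S_def)
  also have "\<dots> = (\<Sum>W | W \<in> L \<and> X \<subseteq> W \<and> W \<subseteq> Y. \<Sum>V | V \<in> L \<and> W \<subseteq> V \<and> V \<subseteq> Y. moebius L W V)"
    using L(1)
    by (subst sum.Sigma, (simp; fail), (simp; fail), subst sum.Sigma, (simp; fail), (simp; fail))
      (rule sum.reindex_bij_witness[where i = "\<lambda>(x, y). (y, x)" and j = "\<lambda>(x, y). (y, x)"], auto)
  also have "\<dots> = (\<Sum>W | W \<in> L \<and> X \<subseteq> W \<and> W \<subseteq> Y. if W = Y then 1 else 0)"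
    using less L by (intro sum.cong refl sum_moebius_right) auto
  also have "\<dots> = 1" using less L by simp
  finally have tot: "(\<Sum>V | V \<in> L \<and> X \<subseteq> V \<and> V \<subseteq> Y. S V) = 1" .
  show ?case
  proof (cases "X = Y")
    case True
    then have "{W. W \<in> L \<and> X \<subseteq> W \<and> W \<subseteq> Y} = {Y}" using less by auto
    then show ?thesis using True by (simp add: moebius.simps)
  next
    case False
    have S: "S V = (if X = V then 1 else 0)" if "V \<in> L" "X \<subseteq> V" "V \<subset> Y" for V
      using less.hyps[of V] that psubset_card_mono[of Y V] less.prems L by (simp add: S_def)
    have "{V. V \<in> L \<and> X \<subseteq> V \<and> V \<subseteq> Y} = insert Y {V. V \<in> L \<and> X \<subseteq> V \<and> V \<subset> Y}"
      using less.prems by auto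
    then have "1 = S Y + (\<Sum>V | V \<in> L \<and> X \<subseteq> V \<and> V \<subset> Y. S V)"
      using tot L by simp
    also have "(\<Sum>V | V \<in> L \<and> X \<subseteq> V \<and> V \<subset> Y. S V) =
        (\<Sum>V | V \<in> L \<and> X \<subseteq> V \<and> V \<subset> Y. if X = V then 1 else 0)"
      using S by (intro sum.cong) auto
    also have "\<dots> = 1" using False assms(3) less.prems L by simp
    finally show ?thesis using False by (simp add: S_def)
  qed
qed

text \<open>The recursion for \<open>moebius L X Y\<close> visits only sets between \<open>X\<close>
  and \<open>Y\<close>, so its value depends only on the order of that interval. The upper bound
  \<open>T\<close> allows passing to a restriction at the same time as \<open>f\<close> passes to a
  contraction.\<close>

lemma moebius_image:
  assumes K: "\<And>W V. W \<in> K \<Longrightarrow> V \<in> K \<Longrightarrow> f W \<subseteq> f V \<longleftrightarrow> W \<subseteq> V"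
    and KL: "K = {W \<in> L. X \<subseteq> W \<and> W \<subseteq> T}" and fin: "\<And>W. W \<in> K \<Longrightarrow> finite W \<and> finite (f W)"
    and "X \<in> K" "Y \<in> K"
  shows "moebius (f ` K) (f X) (f Y) = moebius L X Y"
  using \<open>Y \<in> K\<close>
proof (induction "card Y" arbitrary: Y rule: less_induct)
  case less
  have inj: "inj_on f K" using K by (intro inj_onI) (metis order_refl subset_antisym)
  have XY: "X \<subseteq> Y" using less.prems KL by auto
  show ?case
  proof (cases "X = Y")
    case True
    then show ?thesis by (simp add: moebius.simps)
  next
    case False
    have lt: "X \<subset> Y" "f X \<subset> f Y" using False XY K[OF assms(4) less.prems] inj assms(4) less.prems
      by (auto simp: inj_on_def)
    have set: "{W \<in> f ` K. f X \<subseteq> W \<and> W \<subset> f Y} = f ` {W \<in> L. X \<subseteq> W \<and> W \<subset> Y}"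
    proof -
      have "f W \<subset> f Y \<longleftrightarrow> W \<subset> Y" if "W \<in> K" for W
        using K[OF that less.prems] K[OF less.prems that] by (simp add: less_le_not_le)
      moreover have "{W \<in> L. X \<subseteq> W \<and> W \<subset> Y} = {W \<in> K. X \<subseteq> W \<and> W \<subset> Y}"
        using KL less.prems by auto
      moreover have "{W \<in> f ` K. f X \<subseteq> W \<and> W \<subset> f Y} = f ` {W \<in> K. f X \<subseteq> f W \<and> f W \<subset> f Y}"
        by blast
      ultimately show ?thesis using K[OF assms(4)] by (simp cong: conj_cong)
    qed
    have sub: "{W \<in> L. X \<subseteq> W \<and> W \<subset> Y} \<subseteq> K" using KL less.prems by auto
    have "moebius (f ` K) (f X) (f Y) = - (\<Sum>W\<in>f ` {W \<in> L. X \<subseteq> W \<and> W \<subset> Y}. moebius (f ` K) (f X) W)"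
      using lt fin less.prems unfolding set[symmetric] by (subst moebius.simps) auto
    also have "\<dots> = - (\<Sum>W\<in>{W \<in> L. X \<subseteq> W \<and> W \<subset> Y}. moebius (f ` K) (f X) (f W))"
      using inj_on_subset[OF inj sub] by (simp add: sum.reindex)
    also have "\<dots> = - (\<Sum>W\<in>{W \<in> L. X \<subseteq> W \<and> W \<subset> Y}. moebius L X W)"
    proof -
      have "moebius (f ` K) (f X) (f W) = moebius L X W" if "W \<in> {W \<in> L. X \<subseteq> W \<and> W \<subset> Y}" for W
        using that sub less.hyps[of W] psubset_card_mono[of Y W] fin less.prems by auto
      then show ?thesis by simp
    qed
    also have "\<dots> = moebius L X Y"
      using lt fin less.prems by (subst (2) moebius.simps) auto
    finally show ?thesis .
  qed
qed

section \<open>Characteristic polynomials of minors as sums over intervals of flats\<close>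

definition interval_char :: "'a matroid \<Rightarrow> 'a set \<Rightarrow> 'a set \<Rightarrow> int poly" where
  "interval_char M F G = (\<Sum>H | H \<in> flats M \<and> F \<subseteq> H \<and> H \<subseteq> G.
     monom (moebius (flats M) F H) (rank_of M G - rank_of M H))"

text \<open>The flats of the minor are the sets \<open>H - F\<close> for flats \<open>H\<close>
  between \<open>F\<close> and \<open>G\<close>. This correspondence preserves inclusion and shifts
  all ranks by \<open>rank_of M F\<close>, so Moebius values and rank differences can be read off in
  \<open>M\<close> itself.\<close>

lemma char_poly_minor:
  assumes M: "matroid M" and F: "F \<in> flats M" and G: "G \<in> flats M" and FG: "F \<subseteq> G"
  shows "char_poly (restriction (contraction M F) (G - F)) = interval_char M F G"
proof -
  let ?N = "restriction (contraction M F) (G - F)"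
  define K where "K = {H \<in> flats M. F \<subseteq> H \<and> H \<subseteq> G}"
  have sub: "F \<subseteq> ground M" "G \<subseteq> ground M" using F G by (auto simp: flats_def)
  note MF = matroid_contraction[OF M, of F]
  have GF: "G - F \<in> flats (contraction M F)"
    unfolding flats_contraction[OF M sub(1)] using G FG by blast
  have flats: "flats ?N = (\<lambda>H. H - F) ` K"
    unfolding flats_restriction[OF MF GF] flats_contraction[OF M sub(1)] K_def using FG by blast
  have inj: "inj_on (\<lambda>H. H - F) K" by (rule inj_onI) (auto simp: K_def)
  have rank: "rank_of ?N (H - F) = rank_of M H - rank_of M F" if "F \<subseteq> H" "H \<subseteq> G" for H
  proof -
    have "F \<union> (H - F) = H" using that by auto
    then show ?thesis using that sub
      by (subst rank_of_restriction) (auto simp: rank_of_contraction[OF M] Diff_mono)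
  qed
  have fin: "finite H" if "H \<in> K" for H
    using that matroid_finite_ground[OF M] by (auto simp: K_def flats_def intro: finite_subset)
  have mo: "moebius (flats ?N) {} (H - F) = moebius (flats M) F H" if "H \<in> K" for H
  proof -
    have "moebius ((\<lambda>H. H - F) ` K) (F - F) (H - F) = moebius (flats M) F H"
      by (rule moebius_image[where T = G]) (use that F FG fin in \<open>auto simp: K_def\<close>)
    then show ?thesis by (simp add: flats)
  qed
  have "char_poly ?N = (\<Sum>H\<in>K. monom (moebius (flats ?N) {} (H - F)) (rk ?N - rank_of ?N (H - F)))"
    unfolding char_poly_def by (subst (1) flats, subst sum.reindex[OF inj]) simp
  also have "\<dots> = (\<Sum>H\<in>K. monom (moebius (flats M) F H) (rank_of M G - rank_of M H))"
  proof (rule sum.cong)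
    fix H assume H: "H \<in> K"
    have "rk ?N - rank_of ?N (H - F) = rank_of M G - rank_of M H"
      using rank[of G] rank[of H] H FG rank_of_mono[OF M, of F H] by (auto simp: rk_def K_def)
    then show "monom (moebius (flats ?N) {} (H - F)) (rk ?N - rank_of ?N (H - F)) =
        monom (moebius (flats M) F H) (rank_of M G - rank_of M H)"
      using mo[OF H] by simp
  qed simp
  finally show ?thesis by (simp add: interval_char_def K_def)
qed

text \<open>After exchanging the sums, the coefficient belonging to \<open>H\<close> is a left-hand
  Moebius sum from \<open>{}\<close> to \<open>H\<close>, which vanishes unless
  \<open>H = {}\<close>.\<close>

lemma sum_interval_char:
  assumes M: "matroid M" and "loopless M" and G: "G \<in> flats M"
  shows "(\<Sum>F | F \<in> flats M \<and> F \<subseteq> G. interval_char M F G) = monom 1 (rank_of M G)"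
proof -
  note [simp] = finite_flats[OF M]
  have fin: "finite W" if "W \<in> flats M" for W
    using that matroid_finite_ground[OF M] by (auto simp: flats_def intro: finite_subset)
  have e: "{} \<in> flats M" by (rule empty_in_flats[OF assms(1,2)])
  \<comment> \<open>The trivial condition \<open>{} \<subseteq> F\<close> is inserted to match the
    form of \<open>sum_moebius_left\<close>.\<close>
  have "(\<Sum>F | F \<in> flats M \<and> F \<subseteq> G. interval_char M F G) =
      (\<Sum>H | H \<in> flats M \<and> H \<subseteq> G. \<Sum>F | F \<in> flats M \<and> {} \<subseteq> F \<and> F \<subseteq> H.
         monom (moebius (flats M) F H) (rank_of M G - rank_of M H))"
    unfolding interval_char_def
    by (subst sum.Sigma, (simp; fail), (simp; fail), subst sum.Sigma, (simp; fail), (simp; fail))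
      (rule sum.reindex_bij_witness[where i = "\<lambda>(x, y). (y, x)" and j = "\<lambda>(x, y). (y, x)"], auto)
  also have "\<dots> = (\<Sum>H | H \<in> flats M \<and> H \<subseteq> G.
      monom (\<Sum>F | F \<in> flats M \<and> {} \<subseteq> F \<and> F \<subseteq> H. moebius (flats M) F H) (rank_of M G - rank_of M H))"
    by (simp only: monom_sum)
  also have "\<dots> = (\<Sum>H | H \<in> flats M \<and> H \<subseteq> G.
      monom (if {} = H then 1 else 0) (rank_of M G - rank_of M H))"
    using e fin by (intro sum.cong refl, subst sum_moebius_left) auto
  also have "\<dots> = (\<Sum>H\<in>{{}}. monom (if {} = H then 1 else 0) (rank_of M G - rank_of M H))"
    using e by (intro sum.mono_neutral_right) auto
  also have "\<dots> = monom 1 (rank_of M G)" using M by simp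
  finally show ?thesis .
qed

subsection \<open>Kazhdan--Lusztig polynomials through the palindromic Z-polynomial\<close>

lemma coeff_rev_poly:
  assumes "degree p \<le> n"
  shows "coeff (rev_poly n p) k = (if k \<le> n then coeff p (n - k) else 0)"
  using assms by (auto simp: rev_poly_def coeff_monom_mult coeff_reflect_poly coeff_eq_0)

lemma rev_poly_sum:
  assumes "finite S" "\<And>x. x \<in> S \<Longrightarrow> degree (f x) \<le> n"
  shows "rev_poly n (sum f S) = (\<Sum>x\<in>S. rev_poly n (f x))"
  by (rule poly_eqI) (use assms in \<open>simp add: coeff_rev_poly degree_sum_le coeff_sum\<close>)

lemma rev_poly_diff:
  assumes "degree p \<le> n" "degree q \<le> n"
  shows "rev_poly n (p - q) = rev_poly n p - rev_poly n q"
  by (rule poly_eqI) (use assms in \<open>simp add: coeff_rev_poly degree_diff_le\<close>)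

lemma rev_poly_monom_mult:
  assumes "k \<le> n" "degree p \<le> n - k"
  shows "rev_poly n (monom 1 k * p) = rev_poly (n - k) p"
proof (rule poly_eqI)
  fix j
  have "degree (monom 1 k * p) \<le> n"
    using degree_mult_le[of "monom 1 k" p] degree_monom_le[of "1::int" k] assms by linarith
  moreover have "n - j - k = n - k - j" by simp
  ultimately show "coeff (rev_poly n (monom 1 k * p)) j = coeff (rev_poly (n - k) p) j"
    using assms by (auto simp: coeff_rev_poly coeff_monom_mult)
qed

text \<open>A palindrome of low degree vanishes: reversal pairs each coefficient below the middle
  with one beyond the degree. This is the source of uniqueness.\<close>

lemma rev_poly_fixed_imp_0:
  assumes "2 * degree p < n" "rev_poly n p = p"
  shows "p = 0"
proof (rule poly_eqI)
  fix k
  have "coeff p k = coeff (rev_poly n p) k" by (simp add: assms(2))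
  also have "\<dots> = (if k \<le> n then coeff p (n - k) else 0)"
    using assms(1) by (intro coeff_rev_poly) simp
  finally show "coeff p k = coeff 0 k"
    using assms(1) by (cases "2 * k < n") (auto simp: coeff_eq_0)
qed

text \<open>The \<open>Z\<close>-polynomial formed from an arbitrary candidate \<open>P\<close>, so
  that it can be studied before \<open>kl_poly\<close> is known to be well defined.\<close>

definition zsum :: "('a matroid \<Rightarrow> int poly) \<Rightarrow> 'a matroid \<Rightarrow> int poly" where
  "zsum P M = (\<Sum>F\<in>flats M. monom 1 (rank_of M F) * P (contraction M F))"

definition klsum :: "('a matroid \<Rightarrow> int poly) \<Rightarrow> 'a matroid \<Rightarrow> int poly" where
  "klsum P M = (\<Sum>F\<in>flats M. char_poly (restriction M F) * P (contraction M F))"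

lemma klsum_contraction:
  assumes M: "matroid M" and F: "F \<in> flats M"
  shows "klsum P (contraction M F) =
    (\<Sum>G | G \<in> flats M \<and> F \<subseteq> G. interval_char M F G * P (contraction M G))"
proof -
  have sub: "F \<subseteq> ground M" using F by (auto simp: flats_def)
  have inj: "inj_on (\<lambda>G. G - F) {G \<in> flats M. F \<subseteq> G}" by (rule inj_onI) auto
  have "klsum P (contraction M F) = (\<Sum>G | G \<in> flats M \<and> F \<subseteq> G.
      char_poly (restriction (contraction M F) (G - F)) * P
          (contraction (contraction M F) (G - F)))"
    unfolding klsum_def flats_contraction[OF M sub] sum.reindex[OF inj] by simp
  also have "\<dots> = (\<Sum>G | G \<in> flats M \<and> F \<subseteq> G. interval_char M F G * P (contraction M G))"
  proof (rule sum.cong)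
    fix G assume "G \<in> {G. G \<in> flats M \<and> F \<subseteq> G}"
    then have G: "G \<in> flats M" "F \<subseteq> G" "G \<subseteq> ground M" by (auto simp: flats_def)
    then show "char_poly (restriction (contraction M F) (G - F)) *
        P (contraction (contraction M F) (G - F)) =
        interval_char M F G * P (contraction M G)"
      using char_poly_minor[OF M F G(1,2)] contraction_contraction[OF M G(2,3)] by simp
  qed simp
  finally show ?thesis .
qed

text \<open>Expanding each summand over the flats \<open>G\<close> above \<open>F\<close> and
  exchanging the sums, the factors of \<open>P (contraction M G)\<close> add up to a power of
  \<open>t\<close> by \<open>sum_interval_char\<close>.\<close>

lemma sum_klsum_contraction:
  assumes M: "matroid M" and "loopless M"
  shows "(\<Sum>F\<in>flats M. klsum P (contraction M F)) = zsum P M"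
proof -
  note [simp] = finite_flats[OF M]
  have "(\<Sum>F\<in>flats M. klsum P (contraction M F)) =
     (\<Sum>F\<in>flats M. \<Sum>G | G \<in> flats M \<and> F \<subseteq> G. interval_char M F G * P (contraction M G))"
    by (intro sum.cong refl klsum_contraction[OF M])
  also have "\<dots> = (\<Sum>G\<in>flats M. \<Sum>F | F \<in> flats M \<and> F \<subseteq> G. interval_char M F G * P (contraction M G))"
    by (subst sum.Sigma, (simp; fail), (simp; fail), subst sum.Sigma, (simp; fail), (simp; fail))
      (rule sum.reindex_bij_witness[where i = "\<lambda>(x, y). (y, x)" and j = "\<lambda>(x, y). (y, x)"], auto)
  also have "\<dots> = zsum P M"
    unfolding zsum_def using sum_interval_char[OF assms]
    by (intro sum.cong refl) (simp flip: sum_distrib_right)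
  finally show ?thesis .
qed

lemma card_ground_contraction_less:
  assumes "matroid M" "F \<in> flats M" "F \<noteq> {}"
  shows "card (ground (contraction M F)) < card (ground M)"
proof -
  have "ground (contraction M F) \<subset> ground M"
    using assms(2,3) by (auto simp: flats_def)
  then show ?thesis using matroid_finite_ground[OF assms(1)] psubset_card_mono by blast
qed

context
  fixes P :: "'a matroid \<Rightarrow> int poly"
  assumes deg: "\<And>M. matroid M \<Longrightarrow> loopless M \<Longrightarrow> degree (P M) \<le> rk M"
begin

lemma degree_zsum_summand:
  assumes M: "matroid M" and F: "F \<in> flats M"
  shows "degree (monom 1 (rank_of M F) * P (contraction M F)) \<le> rk M"
proof -
  have "F \<subseteq> ground M" using F by (auto simp: flats_def)
  then have "degree (P (contraction M F)) \<le> rk M - rank_of M F" "rank_of M F \<le> rk M"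
    using deg[OF matroid_contraction[OF M] loopless_contraction[OF M F]] rk_contraction[OF M]
      rank_of_mono[OF M] by (auto simp: rk_def)
  then show ?thesis
    using degree_mult_le[of "monom 1 (rank_of M F)" "P (contraction M F)"]
      degree_monom_le[of "1::int" "rank_of M F"] by linarith
qed

lemma degree_zsum: "matroid M \<Longrightarrow> degree (zsum P M) \<le> rk M"
  unfolding zsum_def by (intro degree_sum_le finite_flats degree_zsum_summand)

text \<open>The factor of degree \<open>rank_of M F\<close> turns reversal at \<open>rk M\<close>
  into reversal at the rank of the contraction. The bound \<open>deg\<close> keeps all degrees
  within the range where reversal acts coefficientwise.\<close>

lemma rev_poly_zsum:
  assumes M: "matroid M"
  shows "rev_poly (rk M) (zsum P M) =
    (\<Sum>F\<in>flats M. rev_poly (rk (contraction M F)) (P (contraction M F)))"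
proof -
  have "rev_poly (rk M) (zsum P M) =
      (\<Sum>F\<in>flats M. rev_poly (rk M) (monom 1 (rank_of M F) * P (contraction M F)))"
    unfolding zsum_def by (intro rev_poly_sum finite_flats degree_zsum_summand M)
  also have "\<dots> = (\<Sum>F\<in>flats M. rev_poly (rk (contraction M F)) (P (contraction M F)))"
  proof (rule sum.cong)
    fix F assume F: "F \<in> flats M"
    then have "F \<subseteq> ground M" by (auto simp: flats_def)
    then show "rev_poly (rk M) (monom 1 (rank_of M F) * P (contraction M F)) =
        rev_poly (rk (contraction M F)) (P (contraction M F))"
      using deg[OF matroid_contraction[OF M] loopless_contraction[OF M F]] rk_contraction[OF M]
        rank_of_mono[OF M] by (subst rev_poly_monom_mult) (auto simp: rk_def)
  qed simp
  finally show ?thesis .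
qed

lemma zsum_palindromic:
  assumes kl: "\<And>M. matroid M \<Longrightarrow> loopless M \<Longrightarrow> rev_poly (rk M) (P M) = klsum P M"
    and M: "matroid M" "loopless M"
  shows "rev_poly (rk M) (zsum P M) = zsum P M"
proof -
  have "rev_poly (rk M) (zsum P M) = (\<Sum>F\<in>flats M. klsum P (contraction M F))"
    unfolding rev_poly_zsum[OF M(1)]
    by (intro sum.cong refl kl matroid_contraction loopless_contraction M)
  then show ?thesis by (simp add: sum_klsum_contraction[OF M])
qed

text \<open>Palindromicity equates the sums over all flats of the two sides of the defining
  equation. By induction the summands agree at every nonempty flat, hence also at \<open>{}\<close>,
  whose contraction is \<open>M\<close> itself.\<close>

lemma kl_if_zsum_palindromic:
  assumes pal: "\<And>M. matroid M \<Longrightarrow> loopless M \<Longrightarrow> rev_poly (rk M) (zsum P M) = zsum P M"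
    and "matroid M" "loopless M"
  shows "rev_poly (rk M) (P M) = klsum P M"
  using assms(2,3)
proof (induction "card (ground M)" arbitrary: M rule: less_induct)
  case less
  note M = less.prems
  have e: "{} \<in> flats M" by (rule empty_in_flats[OF M])
  let ?f = "\<lambda>F. rev_poly (rk (contraction M F)) (P (contraction M F))"
  let ?g = "\<lambda>F. klsum P (contraction M F)"
  have "sum ?f (flats M) = sum ?g (flats M)"
    using rev_poly_zsum[OF M(1)] sum_klsum_contraction[OF M, of P] pal[OF M] by simp
  moreover have "sum ?f (flats M - {{}}) = sum ?g (flats M - {{}})"
    by (intro sum.cong refl less.hyps card_ground_contraction_less matroid_contraction
        loopless_contraction M) auto
  ultimately have "?f {} = ?g {}"
    using sum.remove[OF finite_flats[OF M(1)] e, of ?f]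
        sum.remove[OF finite_flats[OF M(1)] e, of ?g]
    by simp
  then show ?case by (simp add: contraction_empty[OF M(1)])
qed

end

section \<open>Existence and uniqueness of the Kazhdan--Lusztig assignment\<close>

lemma zsum_remove_empty:
  assumes "matroid M" "loopless M"
  shows "zsum P M = P M + (\<Sum>F\<in>flats M - {{}}. monom 1 (rank_of M F) * P (contraction M F))"
  unfolding zsum_def
  by (subst sum.remove[OF finite_flats[OF assms(1)] empty_in_flats[OF assms]])
    (simp add: assms contraction_empty monom_0 flip: one_pCons)

lemma kl_assignment_iff:
  "kl_assignment P \<longleftrightarrow> (\<forall>M. matroid M \<longrightarrow> loopless M \<longrightarrow> (rk M = 0 \<longrightarrow> P M = 1) \<and>
     (rk M > 0 \<longrightarrow> 2 * degree (P M) < rk M) \<and> rev_poly (rk M) (P M) = klsum P M)"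
proof -
  have "real k < real r / 2 \<longleftrightarrow> 2 * k < r" for k r :: nat by linarith
  then show ?thesis unfolding kl_assignment_def klsum_def by simp
qed

lemma kl_assignment_degree:
  assumes "kl_assignment P" "matroid M" "loopless M"
  shows "degree (P M) \<le> rk M"
  using assms unfolding kl_assignment_iff by (cases "rk M = 0") fastforce+

lemma kl_assignment_palindromic:
  assumes "kl_assignment P" "matroid M" "loopless M"
  shows "rev_poly (rk M) (zsum P M) = zsum P M"
  by (rule zsum_palindromic) (use assms kl_assignment_degree in \<open>auto simp: kl_assignment_iff\<close>)

text \<open>By induction the two \<open>Z\<close>-polynomials differ exactly by
  \<open>P M - Q M\<close>. This difference is palindromic with respect to \<open>rk M\<close> but
  has degree below half of it, so it is zero.\<close>

lemma kl_assignment_unique: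
  assumes P: "kl_assignment P" and Q: "kl_assignment Q" and "matroid M" "loopless M"
  shows "P M = Q M"
  using assms(3,4)
proof (induction "card (ground M)" arbitrary: M rule: less_induct)
  case less
  note M = less.prems
  show ?case
  proof (cases "rk M = 0")
    case True
    then show ?thesis using P Q M by (simp add: kl_assignment_iff)
  next
    case False
    have "(\<Sum>F\<in>flats M - {{}}. monom 1 (rank_of M F) * P (contraction M F)) =
        (\<Sum>F\<in>flats M - {{}}. monom 1 (rank_of M F) * Q (contraction M F))"
      by (intro sum.cong refl arg_cong[where f = "(*) _"] less.hyps card_ground_contraction_less
          matroid_contraction loopless_contraction M) auto
    then have diff: "zsum P M - zsum Q M = P M - Q M"
      by (simp add: zsum_remove_empty[OF M])
    have "rev_poly (rk M) (zsum P M - zsum Q M) = zsum P M - zsum Q M"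
      using kl_assignment_palindromic[OF P M] kl_assignment_palindromic[OF Q M]
        degree_zsum[of P] degree_zsum[of Q] kl_assignment_degree[OF P] kl_assignment_degree[OF Q] M
      by (simp add: rev_poly_diff)
    moreover have "2 * degree (P M - Q M) < rk M"
    proof -
      have "2 * degree (P M) < rk M" "2 * degree (Q M) < rk M"
        using P Q M False by (simp_all add: kl_assignment_iff)
      then show ?thesis using degree_diff_le_max[of "P M" "Q M"] by linarith
    qed
    ultimately have "P M - Q M = 0"
      unfolding diff by (intro rev_poly_fixed_imp_0) auto
    then show ?thesis by simp
  qed
qed

text \<open>The correction, supported strictly below degree \<open>r / 2\<close>, that makes its sum
  with \<open>S\<close> palindromic: the upper coefficients of \<open>S\<close> are kept and the
  lower ones are adjusted to them.\<close>

definition pal_completion :: "nat \<Rightarrow> int poly \<Rightarrow> int poly" where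
  "pal_completion r S = (\<Sum>i | 2 * i < r. monom (coeff S (r - i) - coeff S i) i)"

lemma coeff_pal_completion:
  "coeff (pal_completion r S) i = (if 2 * i < r then coeff S (r - i) - coeff S i else 0)"
proof -
  have "finite {i. 2 * i < r}" by (rule finite_subset[of _ "{..r}"]) auto
  then show ?thesis by (simp add: pal_completion_def coeff_sum)
qed

lemma degree_pal_completion:
  assumes "r > 0"
  shows "2 * degree (pal_completion r S) < r"
proof (cases "pal_completion r S = 0")
  case False
  then have "coeff (pal_completion r S) (degree (pal_completion r S)) \<noteq> 0" by simp
  then show ?thesis unfolding coeff_pal_completion by (auto split: if_splits)
qed (use assms in simp)

lemma pal_completion:
  assumes "degree S \<le> r" "r > 0"
  shows "rev_poly r (pal_completion r S + S) = pal_completion r S + S"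
proof (rule poly_eqI)
  fix k
  have d: "degree (pal_completion r S + S) \<le> r"
    using degree_pal_completion[OF assms(2), of S] assms(1) by (intro degree_add_le) auto
  show "coeff (rev_poly r (pal_completion r S + S)) k = coeff (pal_completion r S + S) k"
  proof (cases "k \<le> r")
    case True
    \<comment> \<open>For even \<open>r\<close> the middle coefficient is paired with itself and
      receives no correction.\<close>
    have "coeff S (r - k) = coeff S k" if "2 * k = r"
      using that by (intro arg_cong[where f = "coeff S"]) auto
    then show ?thesis using True unfolding coeff_rev_poly[OF d] coeff_add coeff_pal_completion
      by (auto simp: not_less le_less)
  next
    case False
    then show ?thesis
      unfolding coeff_rev_poly[OF d] using d by (simp add: coeff_eq_0 del: coeff_add)
  qed
qed

text \<open>Rank zero is treated separately because \<open>pal_completion 0\<close> is the zero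
  polynomial. The outer default 0 agrees with the dummy value in \<open>kl_poly\<close>.\<close>

function kl_rec :: "'a matroid \<Rightarrow> int poly" where
  "kl_rec M = (if matroid M \<and> loopless M then
     (if rk M = 0 then 1 else
       pal_completion (rk M)
         (\<Sum>F\<in>flats M - {{}}. monom 1 (rank_of M F) * kl_rec (contraction M F))) else 0)"
  by pat_completeness auto
termination
  by (relation "measure (\<lambda>M. card (ground M))")
      (auto simp del: ground_contraction intro!: card_ground_contraction_less)

declare kl_rec.simps [simp del]

text \<open>The recursion builds in the degree bound and the palindromicity of \<open>zsum\<close>;
  \<open>kl_if_zsum_palindromic\<close> converts the latter into the defining equation.\<close>

lemma kl_assignment_kl_rec: "kl_assignment (kl_rec :: 'a matroid \<Rightarrow> int poly)"
proof -
  have deg2: "2 * degree (kl_rec M) < rk M" if "matroid M" "loopless M" "rk M > 0"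
      for M :: "'a matroid"
    using that by (simp add: kl_rec.simps[of M] degree_pal_completion)
  have one: "kl_rec M = 1" if "matroid M" "loopless M" "rk M = 0" for M :: "'a matroid"
    using that by (simp add: kl_rec.simps[of M])
  have deg: "degree (kl_rec M) \<le> rk M" if "matroid M" "loopless M" for M :: "'a matroid"
    using deg2[OF that] one[OF that] by (cases "rk M = 0") auto
  have pal: "rev_poly (rk M) (zsum kl_rec M) = zsum kl_rec M" if M: "matroid M" "loopless M"
      for M :: "'a matroid"
  proof (cases "rk M = 0")
    case True
    then have "degree (zsum kl_rec M) = 0" using degree_zsum[of kl_rec M] deg M by simp
    then show ?thesis using True by (intro poly_eqI) (auto simp: coeff_rev_poly coeff_eq_0)
  next
    case False
    define S where "S = (\<Sum>F\<in>flats M - {{}}. monom 1 (rank_of M F) * kl_rec (contraction M F))"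
    have "kl_rec M = pal_completion (rk M) S"
      using M False by (simp add: kl_rec.simps[of M] S_def)
    then have "zsum kl_rec M = pal_completion (rk M) S + S"
      by (simp add: zsum_remove_empty[OF M] S_def)
    moreover have "degree S \<le> rk M"
      unfolding S_def using M finite_flats[OF M(1)]
      by (intro degree_sum_le degree_zsum_summand deg) auto
    ultimately show ?thesis using pal_completion False by simp
  qed
  have "rev_poly (rk M) (kl_rec M) = klsum kl_rec M" if "matroid M" "loopless M"
      for M :: "'a matroid"
    using kl_if_zsum_palindromic[OF deg pal that] .
  then show ?thesis using deg2 one by (simp add: kl_assignment_iff)
qed

lemma kl_assignment_kl_poly: "kl_assignment (kl_poly :: 'a matroid \<Rightarrow> int poly)"
proof -
  have "kl_poly = (kl_rec :: 'a matroid \<Rightarrow> int poly)"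
    unfolding kl_poly_def
  proof (rule the_equality)
    show "kl_assignment kl_rec \<and> (\<forall>M. \<not> (matroid M \<and> loopless M) \<longrightarrow> kl_rec (M :: 'a matroid) = 0)"
      using kl_assignment_kl_rec by (auto simp: kl_rec.simps)
    fix P :: "'a matroid \<Rightarrow> int poly"
    assume P: "kl_assignment P \<and> (\<forall>M. \<not> (matroid M \<and> loopless M) \<longrightarrow> P M = 0)"
    show "P = kl_rec"
    proof
      fix M :: "'a matroid"
      show "P M = kl_rec M"
      proof (cases "matroid M \<and> loopless M")
        case True
        then show ?thesis using kl_assignment_unique[OF _ kl_assignment_kl_rec] P by blast
      next
        case False
        then show ?thesis using P by (subst kl_rec.simps) auto
      qed
    qed
  qed
  then show ?thesis using kl_assignment_kl_rec by simp
qed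

lemma Z_poly_eq_zsum: "Z_poly M = zsum kl_poly M"
  by (simp add: Z_poly_def zsum_def rk_def rank_of_restriction)

subsection \<open>Binomial sums\<close>

text \<open>The number of multisets of size \<open>h\<close> from \<open>j\<close> elements. The
  subtraction is real, so that \<open>multichoose 0 0\<close> is the binomial coefficient of -1 over
  0, which is 1.\<close>

definition multichoose :: "nat \<Rightarrow> nat \<Rightarrow> real" where
  "multichoose j h = (real j - 1 + real h) gchoose h"

lemma multichoose_0: "multichoose 0 h = (if h = 0 then 1 else 0)"
proof (cases h)
  case (Suc k)
  have "real k gchoose Suc k = 0"
    by (metis binomial_gbinomial binomial_eq_0 lessI of_nat_0)
  then show ?thesis using Suc by (simp add: multichoose_def)
qed (simp add: multichoose_def)

lemma multichoose_Suc: "multichoose (Suc j) h = real ((j + h) choose h)"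
  by (simp add: multichoose_def binomial_gbinomial)

lemma gchoose_shift: "i \<le> d \<Longrightarrow> (real d - real i + real h) gchoose h = real ((d - i + h) choose h)"
  by (simp add: binomial_gbinomial of_nat_diff algebra_simps)

text \<open>This absorption identity and \<open>choose_Suc_left_real\<close> reduce shifted
  binomials to a common factor, so that later identities become rational ones.\<close>

lemma choose_Suc_real:
    "real ((k + Suc h) choose Suc h) =
        real ((k + h) choose h) * (real k + real h + 1) / (real h + 1)"
proof -
  have "Suc h * (Suc (k + h) choose Suc h) = Suc (k + h) * ((k + h) choose h)"
    by (rule Suc_times_binomial)
  then have "real (Suc h) * real (Suc (k + h) choose Suc h) =
      real (Suc (k + h)) * real ((k + h) choose h)"
    by (metis of_nat_mult)
  then show ?thesis by (simp add: field_simps)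
qed

lemma choose_Suc_left_real:
    "real ((Suc k + h) choose h) = real ((k + h) choose h) * (real k + real h + 1) / (real k + 1)"
proof -
  have "real ((h + Suc k) choose Suc k) =
      real ((h + k) choose k) * (real h + real k + 1) / (real k + 1)"
    by (rule choose_Suc_real)
  moreover have "(h + Suc k) choose Suc k = ((Suc k + h) choose h)"
      "(h + k) choose k = ((k + h) choose h)"
    using binomial_symmetric[of "Suc k" "h + Suc k"] binomial_symmetric[of k "h + k"]
    by (simp_all add: add.commute)
  ultimately show ?thesis by (simp add: algebra_simps)
qed

section \<open>The sum in the coefficient formula, with \<open>n\<close> in place of
  \<open>d - i\<close>, and its symmetry\<close>

definition z_factor :: "nat \<Rightarrow> nat \<Rightarrow> nat \<Rightarrow> real" where
  "z_factor m i n = (\<Sum>h<m. (real i * (real h - real m + 1) + real m) / ((real h + 1) * real m) *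
     multichoose i h * real ((n + h) choose h))"

lemma multichoose_mult: "(real i + real h) * multichoose i h = real i * real ((i + h) choose h)"
proof (cases i)
  case (Suc a)
  then show ?thesis
    unfolding Suc multichoose_Suc choose_Suc_left_real by (simp add: field_simps)
qed (simp add: multichoose_0)

text \<open>Partial fractions in \<open>h + 1\<close>: the weight equals
  \<open>i / m + (1 - i) / (h + 1)\<close>.\<close>

lemma z_factor_split: "m > 0 \<Longrightarrow> z_factor m i n =
   (real i / real m) * (\<Sum>h<m. multichoose i h * real ((n + h) choose h)) +
   (1 - real i) * (\<Sum>h<m. multichoose i h * real ((n + h) choose h) / (real h + 1))"
  unfolding z_factor_def sum_distrib_left sum.distrib[symmetric]
  by (intro sum.cong) (auto simp: field_simps)

lemma multichoose_quot:
    "h > 0 \<Longrightarrow> multichoose i h = real i / (real i + real h) * real ((i + h) choose h)"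
  using multichoose_mult[of i h] by (simp add: field_simps)

text \<open>Both sums telescope, and their contributions to \<open>z_factor m i n - z_factor m n i\<close> cancel.\<close>

lemma multichoose_diff_sums:
  shows "(\<Sum>h<Suc b. real i * multichoose i h * real ((n + h) choose h) -
      real n * multichoose n h * real ((i + h) choose h))
     = (real i - real n) * (real ((i + b) choose b) * real ((n + b) choose b))"
   and "(\<Sum>h<Suc b. ((1 - real i) * multichoose i h * real ((n + h) choose h) -
       (1 - real n) * multichoose n h * real ((i + h) choose h)) / (real h + 1))
     = - (real i - real n) * (real ((i + b) choose b) * real ((n + b) choose b)) / (real b + 1)"
proof (induction b)
  case 0
  { case 1 show ?case by (simp add: multichoose_def) }
  { case 2 show ?case by (simp add: multichoose_def) }
next
  case (Suc b)
  \<comment> \<open>Every binomial at \<open>Suc b\<close> is \<open>I\<close> or \<open>N\<close>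
    times a rational function of \<open>x\<close>, \<open>y\<close> and \<open>z\<close>, so both
    induction steps become polynomial identities.\<close>
  define I N x y z where "I = real ((i + b) choose b)" and "N = real ((n + b) choose b)"
    and "x = real i" and "y = real n" and "z = real b + 1"
  have pos: "x \<ge> 0" "y \<ge> 0" "z > 0" unfolding x_def y_def z_def by auto
  have I: "real ((i + Suc b) choose Suc b) = I * (x + z) / z"
    and N: "real ((n + Suc b) choose Suc b) = N * (y + z) / z"
    unfolding choose_Suc_real I_def N_def x_def y_def z_def by (simp_all add: add.assoc)
  have z: "real (Suc b) = z" by (simp add: z_def)
  have nz: "x + z \<noteq> 0" "y + z \<noteq> 0" using pos by auto
  have nz': "z \<noteq> 0" "z + 1 \<noteq> 0" using pos by auto
  have mi: "multichoose i (Suc b) = x * I / z" "multichoose n (Suc b) = y * N / z"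
    using nz unfolding multichoose_quot[OF zero_less_Suc] I N z x_def[symmetric] y_def[symmetric]
    by simp_all
  { case 1
    have "(x - y) * (I * N) +
        (x * (x * I / z) * (N * (y + z) / z) - y * (y * N / z) * (I * (x + z) / z))
       = (x - y) * (I * (x + z) / z * (N * (y + z) / z))"
      using nz' by (simp add: divide_simps) algebra
    then show ?case
      unfolding sum.lessThan_Suc[of _ "Suc b"] Suc I N mi
      unfolding I_def[symmetric] N_def[symmetric] x_def[symmetric] y_def[symmetric] by blast }
  { case 2
    have "- (x - y) * (I * N) / z +
        ((1 - x) * (x * I / z) * (N * (y + z) / z) - (1 - y) * (y * N / z) * (I * (x + z) / z)) /
            (z + 1)
       = - (x - y) * (I * (x + z) / z * (N * (y + z) / z)) / (z + 1)"
      using nz' by (simp add: divide_simps) algebra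
    then show ?case
      unfolding sum.lessThan_Suc[of _ "Suc b"] Suc I N mi z
      unfolding I_def[symmetric] N_def[symmetric] x_def[symmetric] y_def[symmetric]
          z_def[symmetric] by blast }
qed

lemma z_factor_sym:
  assumes "m > 0"
  shows "z_factor m i n = z_factor m n i"
proof -
  obtain b where b: "m = Suc b" using assms by (cases m) auto
  have "z_factor m i n - z_factor m n i =
     (\<Sum>h<m. real i * multichoose i h * real ((n + h) choose h) - real n * multichoose n h * real
         ((i + h) choose h)) / real m
   + (\<Sum>h<m. ((1 - real i) * multichoose i h * real ((n + h) choose h) - (1 - real n) * multichoose
       n h * real ((i + h) choose h)) / (real h + 1))"
    unfolding z_factor_split[OF assms] sum_subtractf diff_divide_distrib
    by (simp add: sum_distrib_left sum_divide_distrib algebra_simps)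
  also have "\<dots> = 0"
    unfolding b multichoose_diff_sums by (simp add: field_simps)
  finally show ?thesis by simp
qed

lemma z_factor_0: "m > 0 \<Longrightarrow> z_factor m 0 n = 1"
  unfolding z_factor_split
      by (cases m) (simp_all add: multichoose_0 lessThan_Suc_eq_insert_0 sum.insert_if image_iff
          sum.reindex)

text \<open>The normalised convolution: inserting \<open>uniform_kl_coeff\<close> into the
  convolution for \<open>z\<close>, setting \<open>j = i - k\<close> and taking out
  \<open>((d + m) choose i) / n\<close> with \<open>n = d - i\<close> leaves this sum.\<close>

definition kl_convolution :: "nat \<Rightarrow> nat \<Rightarrow> nat \<Rightarrow> real" where
  "kl_convolution m i n =
      (\<Sum>h<m. \<Sum>j\<le>i. real (i choose j) * real ((n + h) choose (h + j + 1)) * multichoose j h)"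

lemma kl_convolution_0: "kl_convolution m i 0 = 0"
  unfolding kl_convolution_def by (intro sum.neutral ballI) auto

lemma kl_convolution_1: "m > 0 \<Longrightarrow> kl_convolution m i 1 = 1"
proof -
  assume "m > 0"
  have "(\<Sum>j\<le>i. real (i choose j) * real ((1 + h) choose (h + j + 1)) * multichoose j h) =
      (if h = 0 then 1 else 0)" for h
  proof -
    have "(\<Sum>j\<le>i. real (i choose j) * real ((1 + h) choose (h + j + 1)) * multichoose j h) =
        (\<Sum>j\<in>{0}. real (i choose j) * real ((1 + h) choose (h + j + 1)) * multichoose j h)"
      by (intro sum.mono_neutral_right) (auto simp: binomial_eq_0)
    then show ?thesis by (simp add: multichoose_0)
  qed
  then show ?thesis using \<open>m > 0\<close> by (simp add: kl_convolution_def)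
qed

text \<open>Pascal's rule, applied twice, lowers the binomial in \<open>n\<close>. Trinomial
  revision then separates it into a factor with \<open>j\<close> and a factor with \<open>h\<close>;
  Vandermonde sums the first and the hockey-stick identity the second.\<close>

lemma kl_convolution_diff2:
  "kl_convolution (Suc b) (Suc a) (n + 2) - 2 * kl_convolution (Suc b) (Suc a) (n + 1) +
      kl_convolution (Suc b) (Suc a) n
     = real ((n + Suc a) choose a) * real ((n + Suc b) choose b)"
proof -
  have tm: "real ((n + 2 + h) choose (h + j + 1)) * multichoose j h -
      2 * (real ((n + 1 + h) choose (h + j + 1)) * multichoose j h)
      + real ((n + h) choose (h + j + 1)) * multichoose j h =
    (if j = 0 then 0 else real (n choose (j - 1)) * real ((n + h) choose h))" for h j
  proof (cases j)
    \<comment> \<open>For \<open>j = 0\<close> only \<open>h = 0\<close> contributes, and there the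
      binomial is linear in \<open>n\<close>.\<close>
    case 0
    then show ?thesis by (simp add: multichoose_0)
  next
    case (Suc k)
    have "real ((n + 2 + h) choose (h + j + 1)) - 2 * real ((n + 1 + h) choose (h + j + 1)) +
        real ((n + h) choose (h + j + 1)) = real ((n + h) choose (h + k))"
      by (simp add: Suc)
    moreover have "((n + h) choose (h + k)) * ((k + h) choose h) =
        (n choose k) * ((n + h) choose h)"
    proof (cases "k \<le> n")
      case True
      then have "((n + h) choose (h + k)) * ((h + k) choose h) =
          ((n + h) choose h) * ((n + h - h) choose (h + k - h))"
        by (intro choose_mult) auto
      then show ?thesis by (simp add: add.commute mult.commute)
    qed (simp add: binomial_eq_0)
    then have "real ((n + h) choose (h + k)) * multichoose j h =
        real (n choose k) * real ((n + h) choose h)"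
      unfolding Suc multichoose_Suc by (metis of_nat_mult)
    ultimately show ?thesis unfolding Suc
      by (simp add: algebra_simps)
  qed
  have vand: "(\<Sum>j\<le>Suc a. real (Suc a choose j) * (if j = 0 then 0 else real (n choose (j - 1)))) =
      real ((n + Suc a) choose a)"
  proof -
    have "(\<Sum>j\<le>Suc a. real (Suc a choose j) * (if j = 0 then 0 else real (n choose (j - 1)))) =
        (\<Sum>k\<le>a. real (Suc a choose Suc k) * real (n choose k))"
      by (subst sum.atMost_Suc_shift) simp
    also have "\<dots> = real (\<Sum>k\<le>a. (n choose k) * (Suc a choose (a - k)))"
    proof -
      have "(Suc a choose Suc k) = (Suc a choose (a - k))" if "k \<le> a" for k
        using that binomial_symmetric[of "Suc k" "Suc a"] by simp
      then show ?thesis by (simp add: mult.commute)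
    qed
    also have "\<dots> = real ((n + Suc a) choose a)" by (simp only: vandermonde)
    finally show ?thesis .
  qed
  have "kl_convolution (Suc b) (Suc a) (n + 2) - 2 * kl_convolution (Suc b) (Suc a) (n + 1) +
      kl_convolution (Suc b) (Suc a) n
    = (\<Sum>h<Suc b. \<Sum>j\<le>Suc a. real (Suc a choose j) *
      (real ((n + 2 + h) choose (h + j + 1)) * multichoose j h - 2 *
          (real ((n + 1 + h) choose (h + j + 1)) * multichoose j h)
      + real ((n + h) choose (h + j + 1)) * multichoose j h))"
    unfolding kl_convolution_def sum_distrib_left sum_subtractf[symmetric] sum.distrib[symmetric]
    by (intro sum.cong refl) (simp only: algebra_simps)
  also have "\<dots> = (\<Sum>h<Suc b. (\<Sum>j\<le>Suc a. real (Suc a choose j) *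
      (if j = 0 then 0 else real (n choose (j - 1)))) * real ((n + h) choose h))"
    unfolding tm sum_distrib_right by (intro sum.cong refl) auto
  also have "\<dots> = real ((n + Suc a) choose a) * real (\<Sum>h\<le>b. (n + h) choose h)"
    unfolding vand lessThan_Suc_atMost of_nat_sum sum_distrib_left ..
  also have "(\<Sum>h\<le>b. (n + h) choose h) = ((n + Suc b) choose b)"
    using sum_choose_lower[of n b] by simp
  finally show ?thesis .
qed

text \<open>Taking \<open>i = a + 1\<close> makes \<open>multichoose\<close> an ordinary binomial,
  and clearing the denominator \<open>m\<close> gives a sensible value at \<open>m = 0\<close>,
  where an induction on \<open>m\<close> can start.\<close>

definition scaled_z_factor :: "nat \<Rightarrow> nat \<Rightarrow> nat \<Rightarrow> real" where
  "scaled_z_factor m a n = (\<Sum>h<m. ((real a + 1) * (real h - real m + 1) + real m) / (real h + 1) *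
     (real ((a + h) choose h) * real ((n + h) choose h)))"

lemma scaled_z_factor_z_factor:
  assumes "m > 0"
  shows "scaled_z_factor m a n = real m * z_factor m (Suc a) n"
proof -
  have "c * (x / (y * c) * p * q) = x / y * (p * q)" if "c \<noteq> 0" for c x y p q :: real
    using that by simp
  then show ?thesis
    unfolding scaled_z_factor_def z_factor_def sum_distrib_left multichoose_Suc using assms
    by (intro sum.cong refl) (simp only: of_nat_Suc add.commute[of 1] of_nat_eq_0_iff neq0_conv)
qed

text \<open>The weight of each \<open>h\<close> equals \<open>(a + 1) - a * m / (h + 1)\<close>,
  which is linear in \<open>m\<close>. The second difference in \<open>m\<close> therefore retains
  only boundary terms from \<open>h = m\<close> and \<open>h = m + 1\<close>.\<close>

lemma scaled_z_factor_rec: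
  "scaled_z_factor (Suc (Suc m)) a n = 2 * scaled_z_factor (Suc m) a n - scaled_z_factor m a n +
    (real ((a + Suc m) choose Suc m) * real ((n + Suc m) choose Suc m)
     - (real m + 1 + real a) / (real m + 1) * (real ((a + m) choose m) * real ((n + m) choose m)))"
proof -
  define B where "B h = real ((a + h) choose h) * real ((n + h) choose h)" for h
  have q: "scaled_z_factor m a n =
      (real a + 1) * (\<Sum>h<m. B h) - real a * real m * (\<Sum>h<m. B h / (real h + 1))" for m
    unfolding scaled_z_factor_def B_def[symmetric] sum_distrib_left sum_subtractf[symmetric]
    by (intro sum.cong refl) (simp add: field_simps)
  define S V c0 c1 where "S = (\<Sum>h<m. B h)" and "V = (\<Sum>h<m. B h / (real h + 1))"
    and "c0 = B m / (real m + 1)" and "c1 = B (Suc m) / (real m + 1 + 1)"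
  have B: "B m = c0 * (real m + 1)" "B (Suc m) = c1 * (real m + 1 + 1)"
    unfolding c0_def c1_def by (simp_all del: of_nat_Suc)
  have c: "(real m + 1 + real a) / (real m + 1) * B m = (real m + 1 + real a) * c0"
    by (simp add: c0_def)
  show ?thesis
    unfolding q B_def[symmetric] c sum.lessThan_Suc of_nat_Suc add.commute[of 1]
      S_def[symmetric] V_def[symmetric] c0_def[symmetric] c1_def[symmetric]
    unfolding B by (simp add: algebra_simps)
qed

text \<open>The second difference in \<open>n\<close> is computed by induction on \<open>m\<close>:
  by \<open>scaled_z_factor_rec\<close> it satisfies a second-order recurrence in \<open>m\<close>,
  which \<open>e\<close> satisfies as well. Here \<open>r\<close> is the prefactor of
  \<open>z_factor\<close> in \<open>kl_convolution_eq_z_factor\<close>, up to a constant.\<close>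

lemma scaled_z_factor_diff2:
  fixes a n m :: nat
  defines "r \<equiv> \<lambda>n. real n * real ((n + Suc a) choose Suc a)"
    and "e \<equiv> \<lambda>m. (real m)^2 / (real n + 1) * real ((Suc a + m) choose m) *
        real ((n + m) choose m) * real ((Suc n + a) choose a)"
  shows "r (Suc (Suc n)) * scaled_z_factor m a (Suc (Suc n)) -
      2 * (r (Suc n) * scaled_z_factor m a (Suc n)) + r n * scaled_z_factor m a n = e m"
proof -
  define D where "D f =
      r (Suc (Suc n)) * f (Suc (Suc n)) - 2 * (r (Suc n) * f (Suc n)) + r n * f n" for f
  define K z x where "K = real ((n + a) choose a)" and "z = real a + 1" and "x = real n"
  have pos: "x \<ge> 0" "z > 0" by (auto simp: x_def z_def)
  have r: "r n = x * K * (x + z) / z" "r (Suc n) = K * (x + z) * (x + z + 1) / z"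
    "r (Suc (Suc n)) = K * (x + z) * (x + z + 1) * (x + z + 2) / (z * (x + 1))"
    using pos unfolding r_def choose_Suc_real choose_Suc_left_real K_def[symmetric]
    by (simp_all add: x_def z_def divide_simps) (simp_all add: algebra_simps)
  \<comment> \<open>The inhomogeneous terms of the two recurrences agree.\<close>
  have step: "D (\<lambda>n. real ((a + Suc m) choose Suc m) * real ((n + Suc m) choose Suc m)
     - (real m + 1 + real a) / (real m + 1) * (real ((a + m) choose m) * real ((n + m) choose m)))
         =
     e (Suc (Suc m)) - 2 * e (Suc m) + e m" for m
  proof -
    define A N y where "A = real ((a + m) choose m)" and "N = real ((n + m) choose m)"
        and "y = real m + 1"
    have y: "y > 0" by (simp add: y_def)
    have m: "real m = y - 1" by (simp add: y_def)
    have a: "real a = z - 1" by (simp add: z_def)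
    have nz: "y \<noteq> 0" "y + 1 \<noteq> 0" "x + 1 \<noteq> 0" "x + 2 \<noteq> 0" "z \<noteq> 0" "1 + y \<noteq> 0" "2 + x \<noteq> 0"
      using y pos by auto
    show ?thesis
      unfolding D_def r e_def choose_Suc_real choose_Suc_left_real A_def[symmetric]
          N_def[symmetric] K_def[symmetric] m of_nat_Suc x_def[symmetric]
      unfolding of_nat_Suc m x_def[symmetric] a using nz
      by (simp add: divide_simps) algebra
  qed
  have "D (scaled_z_factor m a) = e m \<and> D (scaled_z_factor (Suc m) a) = e (Suc m)" for m
  proof (induction m)
    case 0
    \<comment> \<open>At \<open>m = 0\<close> both sides vanish. At \<open>m = 1\<close> the scaled
      factor is constantly 1, so only the second difference of \<open>r\<close> has to be
      computed.\<close>
    have "x + 1 \<noteq> 0" "z \<noteq> 0" using pos by auto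
    moreover have "e (Suc 0) = (z + 1) * K * (x + z) / (x + 1)"
      using pos unfolding e_def choose_Suc_left_real[of n a] K_def[symmetric]
      by (simp add: x_def z_def divide_simps) (simp add: algebra_simps)
    moreover have "K * (x + z) * (x + z + 1) * (x + z + 2) / (z * (x + 1)) -
        2 * (K * (x + z) * (x + z + 1)) / z + x * K * (x + z) / z = (z + 1) * K * (x + z) / (x + 1)"
      using calculation(1,2) by (simp add: divide_simps) algebra
    ultimately show ?case
      unfolding D_def r by (simp add: scaled_z_factor_def) (simp add: e_def)
  next
    case (Suc m)
    have "D (scaled_z_factor (Suc (Suc m)) a) =
        2 * D (scaled_z_factor (Suc m) a) - D (scaled_z_factor m a) +
      D (\<lambda>n. real ((a + Suc m) choose Suc m) * real ((n + Suc m) choose Suc m)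
     - (real m + 1 + real a) / (real m + 1) * (real ((a + m) choose m) * real ((n + m) choose m)))"
      unfolding D_def scaled_z_factor_rec by (simp only: algebra_simps)
    then show ?case using Suc step by simp
  qed
  then show ?thesis unfolding D_def by blast
qed

text \<open>Symmetry moves the value 1 into the first argument, where every weight collapses to
  \<open>1 / m\<close> and \<open>multichoose\<close> to 1; the rest is a hockey-stick sum. This
  supplies the initial value at \<open>n = 1\<close>.\<close>

lemma z_factor_one:
  assumes "m > 0"
  shows "real (Suc i) * z_factor m i 1 = real ((i + m) choose m)"
proof -
  obtain b where m: "m = Suc b" using assms by (cases m) auto
  have coeff: "(real (Suc 0) * (real h - real m + 1) + real m) / ((real h + 1) * real m) =
      1 / real m" for h
  proof -
    have "real (Suc 0) * (real h - real m + 1) + real m = real h + 1" by simp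
    moreover have "real h + 1 \<noteq> 0" by linarith
    ultimately show ?thesis by simp
  qed
  have "z_factor m i 1 = z_factor m 1 i" by (rule z_factor_sym[OF assms])
  also have "\<dots> = (\<Sum>h<m. real ((i + h) choose h) / real m)"
    unfolding z_factor_def One_nat_def multichoose_Suc coeff by simp
  also have "\<dots> = real (\<Sum>h\<le>b. (i + h) choose h) / real m"
    unfolding m lessThan_Suc_atMost by (simp add: sum_divide_distrib)
  also have "(\<Sum>h\<le>b. (i + h) choose h) = ((Suc i + b) choose b)"
    using sum_choose_lower[of i b] by simp
  finally have "z_factor m i 1 = real ((Suc i + b) choose b) / real m" .
  then show ?thesis
    unfolding m choose_Suc_left_real choose_Suc_real
    by (simp add: divide_simps) (simp add: algebra_simps)
qed

text \<open>For positive \<open>i\<close> both sides, as functions of \<open>n\<close>, have the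
  same second difference and agree at 0 and 1. For \<open>i = 0\<close> both equal
  \<open>n\<close>.\<close>

lemma kl_convolution_eq_z_factor:
  assumes m: "m > 0"
  shows "kl_convolution m i n =
      real n * real ((n + i) choose i) / real ((i + m) choose m) * z_factor m i n"
proof (cases i)
  case 0
  have "kl_convolution m 0 n = (\<Sum>h<m. if h = 0 then real n else 0)"
    unfolding kl_convolution_def by (intro sum.cong) (auto simp: multichoose_0)
  also have "\<dots> = real n" using m by simp
  finally show ?thesis using m by (simp add: 0 z_factor_0)
next
  case (Suc a)
  obtain b where b: "m = Suc b" using m by (cases m) auto
  define c where "c = real ((i + m) choose m)"
  define G where "G n = real n * real ((n + i) choose i) / c * z_factor m i n" for n
  have c: "c > 0" by (simp add: c_def)
  have G: "G n = real n * real ((n + Suc a) choose Suc a) * scaled_z_factor m a n / (real m * c)"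
      for n
    using m by (simp add: G_def Suc scaled_z_factor_z_factor)
  have rec: "G (Suc (Suc n)) - 2 * G (Suc n) + G n =
      kl_convolution m i (Suc (Suc n)) - 2 * kl_convolution m i (Suc n) + kl_convolution m i
          n" for n
  proof -
    have "G (Suc (Suc n)) - 2 * G (Suc n) + G n =
      (real (Suc (Suc n)) * real ((Suc (Suc n) + Suc a) choose Suc a) * scaled_z_factor m a
          (Suc (Suc n)) -
      2 * (real (Suc n) * real ((Suc n + Suc a) choose Suc a) * scaled_z_factor m a (Suc n)) +
      real n * real ((n + Suc a) choose Suc a) * scaled_z_factor m a n) / (real m * c)"
      unfolding G by (simp only: add_divide_distrib diff_divide_distrib times_divide_eq_right)
    also have "\<dots> = (real m)\<^sup>2 / (real n + 1) * c * real ((n + m) choose m) *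
        real ((Suc n + a) choose a) / (real m * c)"
      unfolding scaled_z_factor_diff2 by (simp only: c_def Suc)
    also have "\<dots> = real ((n + Suc a) choose a) * (real m / (real n + 1) * real ((n + m) choose m))"
      using c m by (simp add: power2_eq_square)
    also have "real m / (real n + 1) * real ((n + m) choose m) = real ((Suc n + b) choose b)"
      unfolding b choose_Suc_left_real choose_Suc_real by (simp add: divide_simps)
    also have "real ((n + Suc a) choose a) * \<dots> =
        kl_convolution m i (Suc (Suc n)) - 2 * kl_convolution m i (Suc n) + kl_convolution m i n"
      using kl_convolution_diff2[of b a n] by (simp add: b Suc)
    finally show ?thesis .
  qed
  have "G n = kl_convolution m i n \<and> G (Suc n) = kl_convolution m i (Suc n)" for n
  proof (induction n)
    case 0
    have "G (Suc 0) = 1"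
      using z_factor_one[OF m, of i] c by (simp add: G_def c_def divide_simps)
    moreover have "G 0 = 0" by (simp add: G_def)
    ultimately show ?case using kl_convolution_0[of m i] kl_convolution_1[OF m, of i] by simp
  next
    case (Suc n)
    then show ?case using rec[of n] by simp
  qed
  then show ?thesis by (simp add: G_def c_def)
qed

section \<open>Closed coefficient formulas for uniform matroids\<close>

definition uniform_z_coeff :: "nat \<Rightarrow> nat \<Rightarrow> nat \<Rightarrow> real" where
  "uniform_z_coeff m d i = real ((d + m) choose (i + m)) * real ((d + m) choose i) /
     real ((d + m) choose m) * z_factor m i (d - i)"

text \<open>Closed formula for the coefficients of \<open>P\<close> of the uniform matroid. For \<open>i \<ge> d\<close> the
  subtraction truncates, but the binomial coefficients in the sum are then zero.\<close>

definition uniform_kl_coeff :: "nat \<Rightarrow> nat \<Rightarrow> nat \<Rightarrow> real" where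
  "uniform_kl_coeff m d i = real ((d + m) choose i) / real (d - i) *
     (\<Sum>h<m. real ((d - i + h) choose (h + i + 1)) * multichoose i h)"

text \<open>The closed formula obeys the degree bound because every binomial in its sum has its
  lower entry above its upper one.\<close>

lemma uniform_kl_coeff_eq_0: "d \<le> 2 * i \<Longrightarrow> uniform_kl_coeff m d i = 0"
  by (simp add: uniform_kl_coeff_def binomial_eq_0)

lemma uniform_z_coeff_conv:
  assumes m: "m > 0" and i: "i < d"
  shows "uniform_z_coeff m d i =
      (\<Sum>k\<le>i. real ((d + m) choose k) * uniform_kl_coeff m (d - k) (i - k))"
proof -
  define n where "n = d - i"
  have n: "d = n + i" "n > 0" using i by (auto simp: n_def)
  have "((d + m) choose (i + m)) * ((i + m) choose m) =
      ((d + m) choose m) * ((d + m - m) choose (i + m - m))"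
    using i by (intro choose_mult) auto
  then have "real ((d + m) choose (i + m)) * real ((i + m) choose m) =
      real ((d + m) choose m) * real (d choose i)"
    by (metis add_diff_cancel_right' of_nat_mult)
  moreover have "real ((d + m) choose m) > 0" "real ((i + m) choose m) > 0" by simp_all
  ultimately have "real ((d + m) choose (i + m)) / real ((d + m) choose m) =
      real (d choose i) / real ((i + m) choose m)"
    by (simp add: divide_simps)
  then have "uniform_z_coeff m d i =
      real ((d + m) choose i) * (real (d choose i) / real ((i + m) choose m) * z_factor m i n)"
    unfolding uniform_z_coeff_def n_def by (metis mult.assoc mult.commute times_divide_eq_left)
  also have "\<dots> = real ((d + m) choose i) / real n * kl_convolution m i n"
    unfolding kl_convolution_eq_z_factor[OF m] using n by simp
  also have "\<dots> = (\<Sum>j\<le>i. real ((d + m) choose i) / real n *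
      (\<Sum>h<m. real (i choose j) * real ((n + h) choose (h + j + 1)) * multichoose j h))"
    unfolding kl_convolution_def by (subst sum.swap) (simp add: sum_distrib_left)
  \<comment> \<open>Reindexing by \<open>k = i - j\<close> prepares trinomial revision, which turns
    the two outer binomials into \<open>(d + m) choose k\<close> and
    \<open>(d - k + m) choose (i - k)\<close>. The difference \<open>n\<close> is the same for every
    pair \<open>d - k\<close>, \<open>i - k\<close>.\<close>
  also have "\<dots> = (\<Sum>k\<le>i. real ((d + m) choose i) / real n *
      (\<Sum>h<m. real (i choose (i - k)) * real ((n + h) choose (h + (i - k) + 1)) * multichoose
          (i - k) h))"
    by (rule sum.reindex_bij_witness[where i = "\<lambda>j. i - j" and j = "\<lambda>j. i - j"]) auto
  also have "\<dots> = (\<Sum>k\<le>i. real ((d + m) choose k) * uniform_kl_coeff m (d - k) (i - k))"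
  proof (rule sum.cong)
    fix k assume "k \<in> {..i}"
    then have k: "k \<le> i" by simp
    have "((d + m) choose i) * (i choose k) = ((d + m) choose k) * ((d + m - k) choose (i - k))"
      using k i by (intro choose_mult) auto
    moreover have "i choose (i - k) = i choose k" using k binomial_symmetric[of k i] by simp
    moreover have "d + m - k = d - k + m" using k i by simp
    ultimately have e: "real ((d + m) choose i) * real (i choose (i - k)) =
        real ((d + m) choose k) * real ((d - k + m) choose (i - k))"
      by (metis of_nat_mult)
    have "d - k - (i - k) = n" using k i by (simp add: n_def)
    have "real ((d + m) choose i) / real n *
        (\<Sum>h<m. real (i choose (i - k)) * real ((n + h) choose (h + (i - k) + 1)) * multichoose
            (i - k) h)
      = (real ((d + m) choose i) * real (i choose (i - k))) / real n *
          (\<Sum>h<m. real ((n + h) choose (h + (i - k) + 1)) * multichoose (i - k) h)"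
      by (simp add: sum_distrib_left mult.assoc)
    then show "real ((d + m) choose i) / real n *
        (\<Sum>h<m. real (i choose (i - k)) * real ((n + h) choose (h + (i - k) + 1)) * multichoose
            (i - k) h)
      = real ((d + m) choose k) * uniform_kl_coeff m (d - k) (i - k)"
      unfolding uniform_kl_coeff_def \<open>d - k - (i - k) = n\<close> e
      by (simp add: mult.assoc)
  qed simp
  finally show ?thesis .
qed

lemma uniform_z_coeff_sym:
  assumes "m > 0" "i \<le> d"
  shows "uniform_z_coeff m d (d - i) = uniform_z_coeff m d i"
proof -
  have "(d + m) choose (d - i + m) = (d + m) choose i"
      "(d + m) choose (d - i) = (d + m) choose (i + m)"
    using assms(2) binomial_symmetric[of i "d + m"] binomial_symmetric[of "i + m" "d + m"]
        by simp_all
  then show ?thesis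
    using assms z_factor_sym[OF assms(1), of i "d - i"] by (simp add: uniform_z_coeff_def)
qed

lemma uniform_z_coeff_top:
  assumes "m > 0"
  shows "uniform_z_coeff m d d = 1"
proof -
  have "(d + m) choose d = (d + m) choose m" using binomial_symmetric[of d "d + m"] by simp
  then show ?thesis
    using z_factor_sym[OF assms, of d 0] z_factor_0[OF assms] by (simp add: uniform_z_coeff_def)
qed

subsection \<open>Uniform matroids\<close>

lemma ground_uniform_matroid [simp]: "ground (uniform_matroid d E) = E"
  by (simp add: uniform_matroid_def)

lemma matroid_uniform_matroid:
  assumes "finite E"
  shows "matroid (uniform_matroid d E)"
proof -
  have ex: "\<exists>x\<in>J - I. insert x I \<subseteq> E \<and> card (insert x I) \<le> d"
    if "I \<subseteq> E" "J \<subseteq> E" "card J \<le> d" "card I < card J" for I J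
  proof -
    have fin: "finite I" using that assms finite_subset by blast
    then have "\<not> J \<subseteq> I" using that(4) card_mono[of I J] by auto
    then obtain x where "x \<in> J - I" by blast
    then show ?thesis using that fin by (intro bexI[of _ x]) auto
  qed
  have sub: "J \<subseteq> E \<and> card J \<le> d" if "I \<subseteq> E" "card I \<le> d" "J \<subseteq> I" for I J
    using that card_mono[OF finite_subset[OF that(1) assms] that(3)] by simp
  show ?thesis
    unfolding matroid_def
  proof (intro conjI ballI allI impI)
    show "\<exists>x\<in>J - I. insert x I \<in> indeps (uniform_matroid d E)"
      if "I \<in> indeps (uniform_matroid d E)" "J \<in> indeps (uniform_matroid d E)" "card I < card J"
          for I J
      using that ex[of I J] by (simp add: uniform_matroid_def)
    show "J \<in> indeps (uniform_matroid d E)" if "I \<in> indeps (uniform_matroid d E)" "J \<subseteq> I" for I J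
      using that sub[of I J] by (simp add: uniform_matroid_def)
  qed (use assms in \<open>simp_all add: uniform_matroid_def\<close>)
qed

lemma loopless_uniform_matroid: "d > 0 \<Longrightarrow> loopless (uniform_matroid d E)"
  by (simp add: loopless_def uniform_matroid_def)

lemma rank_of_uniform_matroid:
  assumes "finite E" "X \<subseteq> E"
  shows "rank_of (uniform_matroid d E) X = min (card X) d"
proof -
  have fin: "finite X" using assms finite_subset by blast
  obtain B where B: "B \<subseteq> X" "card B = min (card X) d"
    using obtain_subset_with_card_n[of "min (card X) d" X] by auto
  have "basis_in (uniform_matroid d E) X B"
    unfolding basis_in_def
  proof (intro conjI ballI impI)
    show "B \<in> indeps (uniform_matroid d E)" "B \<subseteq> X"
      using B assms by (auto simp: uniform_matroid_def)
    fix I assume I: "I \<in> indeps (uniform_matroid d E)" "B \<subseteq> I" "I \<subseteq> X"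
    then have "card I \<le> card B"
      using B card_mono[OF fin, of I] by (auto simp: uniform_matroid_def)
    then show "I = B" using I card_seteq[of I B] finite_subset[OF I(3) fin] by auto
  qed
  then show ?thesis
    using rank_of_basis[OF matroid_uniform_matroid[OF assms(1)]] B by simp
qed

lemma rk_uniform_matroid: "finite E \<Longrightarrow> d \<le> card E \<Longrightarrow> rk (uniform_matroid d E) = d"
  by (simp add: rk_def rank_of_uniform_matroid)

lemma flats_uniform_matroid:
  assumes "finite E" "d \<le> card E"
  shows "flats (uniform_matroid d E) = insert E {F. F \<subseteq> E \<and> card F < d}"
proof -
  have iff: "rank_of (uniform_matroid d E) F < rank_of (uniform_matroid d E) (insert x F) \<longleftrightarrow>
      card F < d"
    if "F \<subseteq> E" "x \<in> E - F" for F x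
    using that assms finite_subset[of F E] by (auto simp: rank_of_uniform_matroid)
  show ?thesis
  proof (intro equalityI subsetI)
    fix F assume "F \<in> flats (uniform_matroid d E)"
    then have F: "F \<subseteq> E" "\<And>x. x \<in> E - F \<Longrightarrow> card F < d"
      using iff[of F] by (auto simp: flats_def)
    then show "F \<in> insert E {F. F \<subseteq> E \<and> card F < d}" by blast
  next
    fix F assume "F \<in> insert E {F. F \<subseteq> E \<and> card F < d}"
    then show "F \<in> flats (uniform_matroid d E)" using iff[of F] by (auto simp: flats_def)
  qed
qed

lemma contraction_uniform_matroid:
  assumes "finite E" "F \<subseteq> E" "card F \<le> d"
  shows "contraction (uniform_matroid d E) F = uniform_matroid (d - card F) (E - F)"
proof (rule matroid_eqI)
  note M = matroid_uniform_matroid[OF assms(1), of d]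
  show "matroid (contraction (uniform_matroid d E) F)" by (rule matroid_contraction[OF M])
  show "matroid (uniform_matroid (d - card F) (E - F))"
    using assms by (intro matroid_uniform_matroid) auto
  show "ground (contraction (uniform_matroid d E) F) =
      ground (uniform_matroid (d - card F) (E - F))"
    by simp
  fix X assume "X \<subseteq> ground (contraction (uniform_matroid d E) F)"
  then have X: "X \<subseteq> E - F" by simp
  then have "finite X" "finite F" using assms finite_subset by blast+
  moreover have "F \<inter> X = {}" "F \<union> X \<subseteq> E" using X assms by auto
  ultimately show "rank_of (contraction (uniform_matroid d E) F) X =
      rank_of (uniform_matroid (d - card F) (E - F)) X"
    using rank_of_contraction[OF M, of X F] X assms
    by (simp add: rank_of_uniform_matroid card_Un_disjoint)
qed

lemma sum_subsets_by_card:
  fixes g :: "nat \<Rightarrow> real"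
  assumes "finite E"
  shows "(\<Sum>F | F \<subseteq> E \<and> card F < d. g (card F)) = (\<Sum>k<d. real (card E choose k) * g k)"
proof -
  let ?S = "{F. F \<subseteq> E \<and> card F < d}"
  have "(\<Sum>F\<in>?S. g (card F)) = (\<Sum>k<d. \<Sum>F\<in>{F \<in> ?S. card F = k}. g (card F))"
    using assms by (intro sum.group[symmetric]) auto
  also have "\<dots> = (\<Sum>k<d. real (card E choose k) * g k)"
  proof (rule sum.cong)
    fix k assume "k \<in> {..<d}"
    then have "{F \<in> ?S. card F = k} = {F. F \<subseteq> E \<and> card F = k}" by auto
    then show "(\<Sum>F\<in>{F \<in> ?S. card F = k}. g (card F)) = real (card E choose k) * g k"
      using n_subsets[OF assms, of k] by simp
  qed simp
  finally show ?thesis .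
qed

text \<open>The proper flats are grouped by cardinality, since their contributions depend only on
  it. The flat \<open>E\<close> contracts to rank zero and contributes the separate term of degree
  \<open>d\<close>.\<close>

lemma coeff_zsum_uniform_matroid:
  assumes E: "finite E" "d \<le> card E" and P: "kl_assignment P"
    and q: "\<And>F j. F \<subseteq> E \<Longrightarrow> card F < d \<Longrightarrow>
      real_of_int (coeff (P (uniform_matroid (d - card F) (E - F))) j) = q (card F) j"
  shows "real_of_int (coeff (zsum P (uniform_matroid d E)) i) =
    (\<Sum>k<d. real (card E choose k) * (if i < k then 0 else q k (i - k))) + (if i = d then 1 else 0)"
proof -
  let ?U = "uniform_matroid d E"
  let ?S = "{F. F \<subseteq> E \<and> card F < d}"
  note M = matroid_uniform_matroid[OF E(1), of d]
  have flats: "flats ?U = insert E ?S" by (rule flats_uniform_matroid[OF E])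
  have EF: "E \<in> flats ?U" by (simp add: flats)
  have "rk (contraction ?U E) = 0"
    using E by (simp add: rk_contraction[OF M] rk_uniform_matroid rank_of_uniform_matroid)
  then have "P (contraction ?U E) = 1"
    using P matroid_contraction[OF M] loopless_contraction[OF M EF] by (simp add: kl_assignment_iff)
  moreover have "E \<notin> ?S" "finite ?S" using E by auto
  ultimately have "zsum P ?U = monom 1 d + (\<Sum>F\<in>?S. monom 1 (rank_of ?U F) * P (contraction ?U F))"
    unfolding zsum_def flats using E by (simp add: rank_of_uniform_matroid)
  then have "real_of_int (coeff (zsum P ?U) i) = (if i = d then 1 else 0) +
      (\<Sum>F\<in>?S. real_of_int (coeff (monom 1 (rank_of ?U F) * P (contraction ?U F)) i))"
    by (simp add: coeff_sum)
  also have "(\<Sum>F\<in>?S. real_of_int (coeff (monom 1 (rank_of ?U F) * P (contraction ?U F)) i)) =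
      (\<Sum>F\<in>?S. if i < card F then 0 else q (card F) (i - card F))"
    using E q by (intro sum.cong refl)
      (auto simp: rank_of_uniform_matroid contraction_uniform_matroid coeff_monom_mult)
  also have "\<dots> = (\<Sum>k<d. real (card E choose k) * (if i < k then 0 else q k (i - k)))"
    by (rule sum_subsets_by_card[OF E(1)])
  finally show ?thesis by simp
qed

text \<open>Induction on \<open>d\<close> with \<open>m\<close> fixed. The errors of the two closed
  formulas coincide up to degree \<open>d\<close>. The error for \<open>Z\<close> is symmetric under
  \<open>i \<mapsto> d - i\<close>, and the error for \<open>P\<close> vanishes from degree
  \<open>d / 2\<close> on, so both vanish.\<close>

lemma uniform_matroid_coeffs:
  fixes E :: "'a set"
  assumes P: "kl_assignment P" and "m > 0" "d > 0" "finite E" "card E = m + d"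
  shows "real_of_int (coeff (P (uniform_matroid d E)) j) = uniform_kl_coeff m d j \<and>
    (j \<le> d \<longrightarrow> real_of_int (coeff (zsum P (uniform_matroid d E)) j) = uniform_z_coeff m d j)"
  using assms(3-5)
proof (induction d arbitrary: E j rule: less_induct)
  case (less d)
  let ?U = "uniform_matroid d E"
  define p where "p i = real_of_int (coeff (P ?U) i)" for i
  define z where "z i = real_of_int (coeff (zsum P ?U) i)" for i
  note M = matroid_uniform_matroid[OF less.prems(2), of d]
      loopless_uniform_matroid[OF less.prems(1), of E]
  have rk: "rk ?U = d" using less.prems by (simp add: rk_uniform_matroid)
  \<comment> \<open>The term \<open>k = 0\<close> comes from the empty flat and contains the still
    unknown \<open>p\<close>; all others are known by induction.\<close>
  have z: "z i = (\<Sum>k<d. real ((d + m) choose k) *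
      (if i < k then 0 else (if k = 0 then p else uniform_kl_coeff m (d - k)) (i - k))) +
      (if i = d then 1 else 0)" for i
  proof -
    have "real_of_int (coeff (P (uniform_matroid (d - card F) (E - F))) j) =
        (if card F = 0 then p else uniform_kl_coeff m (d - card F)) j"
      if F: "F \<subseteq> E" "card F < d" for F j
    proof (cases "card F = 0")
      case True
      then have "F = {}" using finite_subset[OF F(1) less.prems(2)] by simp
      then show ?thesis by (simp add: p_def)
    next
      case False
      have "finite F" using F less.prems finite_subset by blast
      then have "card (E - F) = m + (d - card F)"
        using F less.prems by (simp add: card_Diff_subset)
      then show ?thesis using less.IH[of "d - card F" "E - F"] F False less.prems by simp
    qed
    from coeff_zsum_uniform_matroid[OF _ _ P this] show ?thesis
      using less.prems by (simp add: z_def add.commute)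
  qed
  have diff: "z i - uniform_z_coeff m d i = p i - uniform_kl_coeff m d i" if "i \<le> d" for i
  proof (cases "i = d")
    case True
    \<comment> \<open>The convolution formula assumes \<open>i < d\<close>. In degree
      \<open>d\<close> the terms with \<open>k > 0\<close> vanish by the degree bound, leaving
      \<open>p d\<close> and the 1 from the flat \<open>E\<close>.\<close>
    have "z d = (\<Sum>k<d. if k = 0 then p d else 0) + 1"
      unfolding z by (intro arg_cong2[where f = "(+)"] sum.cong) (auto simp: uniform_kl_coeff_eq_0)
    then show ?thesis
      using True less.prems uniform_z_coeff_top[OF \<open>m > 0\<close>] by (simp add: uniform_kl_coeff_eq_0)
  next
    case False
    then have i: "i < d" using that by simp
    have "z i = (\<Sum>k\<le>i. real ((d + m) choose k) *
        (if k = 0 then p else uniform_kl_coeff m (d - k)) (i - k))"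
      unfolding z using i by (auto intro!: sum.mono_neutral_cong_right split: if_splits)
    then show ?thesis
      unfolding uniform_z_coeff_conv[OF \<open>m > 0\<close> i]
      by (simp add: sum.remove[of "{..i}" 0])
  qed
  have zsym: "z (d - i) = z i" if "i \<le> d" for i
  proof -
    have "degree (zsum P ?U) \<le> d"
      using degree_zsum[OF kl_assignment_degree[OF P] M(1)] rk by simp
    then have "coeff (rev_poly d (zsum P ?U)) i = coeff (zsum P ?U) (d - i)"
      using that by (simp add: coeff_rev_poly)
    moreover have "rev_poly d (zsum P ?U) = zsum P ?U"
      using kl_assignment_palindromic[OF P M] unfolding rk .
    ultimately show ?thesis unfolding z_def by simp
  qed
  have sym: "p i - uniform_kl_coeff m d i = p (d - i) - uniform_kl_coeff m d (d - i)" if "i \<le> d"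
      for i
    using diff[OF that] diff[of "d - i"] uniform_z_coeff_sym[OF \<open>m > 0\<close> that] zsym[OF that]
    by simp
  have zero: "p i = uniform_kl_coeff m d i" if "d \<le> 2 * i" for i
  proof -
    have "2 * degree (P ?U) < d"
      using P[unfolded kl_assignment_iff, rule_format, OF M] rk less.prems(1) by simp
    then show ?thesis using that by (simp add: p_def coeff_eq_0 uniform_kl_coeff_eq_0)
  qed
  \<comment> \<open>Below the middle, \<open>sym\<close> transfers the claim to
    \<open>d - i\<close>, where \<open>zero\<close> applies.\<close>
  have "p i = uniform_kl_coeff m d i" for i
    using zero[of i] zero[of "d - i"] sym[of i] by (cases "d \<le> 2 * i") auto
  then show ?case using diff[of j] by (simp add: p_def z_def)
qed

theorem theorem1p6:
  fixes m d i :: nat and E :: "'a set"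
  assumes "m > 0" and "d > 0" and "finite E" and "card E = m + d" and "i \<le> d"
  shows "real_of_int (coeff (Z_poly (uniform_matroid d E)) i) =
    (real (d + m) gchoose (i + m)) * (real (d + m) gchoose i) / (real (d + m) gchoose m) *
    (\<Sum>h = 0..m - 1.
       (real i * (real h - real m + 1) + real m) / ((real h + 1) * real m) *
       ((real i - 1 + real h) gchoose h) * ((real d - real i + real h) gchoose h))"
proof -
  have "{0..m - 1} = {..<m}" using assms(1) by auto
  then show ?thesis
    using uniform_matroid_coeffs[OF kl_assignment_kl_poly assms(1-4)] assms(5)
    by (simp only: Z_poly_eq_zsum uniform_z_coeff_def z_factor_def multichoose_def gchoose_shift
        binomial_gbinomial simp_thms)
qed

end
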